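(* For each $n$ let $V=[n]$, $N=\binom n2$, and let $\alpha=(\alpha_e)_{e\in E_n}$ be decomposable, i.e. there exist $d_v$, $v\in V$, such that $\alpha_{vw}=d_vd_w$ for all $vw\in E_n$. Suppose that $d_v\in[\omega^{-1},\omega]$ for all $v\in V$, where $\omega=(\ln n)^{1/10}$, and that $X$ is chosen uniformly at random from the simplex $\{X\in\mathbb{R}_+^N:\sum_{e\in E_n}\alpha_eX_e\le N\}$. Let $\Lambda_X$ be the weight of the minimum length spanning tree of the complete graph $K_n$ when the edge weights are given by $X$. Then, as $n\to\infty$, $$\mathbb{E}[\Lambda_X]\sim\sum_{k=1}^{\infty}\frac{(k-1)!}{D^k}\sum_{\substack{S\subseteq V\\ |S|=k}}\frac{\prod_{v\in S}d_v}{d_S^2},$$ where $d_S=\sum_{v\in S}d_v$ for $S\subseteq V$ and $D=d_V$.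
   Context: $[n]=\{1,\dots,n\}$ and $E_n=\binom{[n]}{2}$ is the set of unordered pairs of vertices, so $|E_n|=N$; each coordinate $X_e$ of $X$ is the weight of edge $e$ of $K_n$. The notation $a_n\sim b_n$ means $\lim_{n\to\infty}a_n/b_n=1$ (assuming $b_n>0$ for all $n$). *)

theory Defs
  imports "HOL-Analysis.Analysis" "HOL-Library.Landau_Symbols"
begin

definition complete_edges :: "nat \<Rightarrow> nat set set" where
  "complete_edges n = {e. e \<subseteq> {1..n} \<and> card e = 2}"

definition connected_graph :: "'a set \<Rightarrow> 'a set set \<Rightarrow> bool" where
  "connected_graph V T \<longleftrightarrow> (\<forall>u\<in>V. \<forall>v\<in>V. (u, v) \<in> {(x, y). {x, y} \<in> T}\<^sup>*)"

text \<open>A cycle is given by the list of its vertices, without repeating the first one at the end.\<close>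

definition graph_cycle :: "'a set set \<Rightarrow> 'a list \<Rightarrow> bool" where
  "graph_cycle T c \<longleftrightarrow> 3 \<le> length c \<and> distinct c \<and>
     (\<forall>i<length c. {c ! i, c ! (Suc i mod length c)} \<in> T)"

definition spanning_trees :: "nat \<Rightarrow> nat set set set" where
  "spanning_trees n =
     {T. T \<subseteq> complete_edges n \<and> connected_graph {1..n} T \<and> (\<nexists>c. graph_cycle T c)}"

definition mst_weight :: "nat \<Rightarrow> (nat set \<Rightarrow> real) \<Rightarrow> real" where
  "mst_weight n X = Min ((\<lambda>T. \<Sum>e\<in>T. X e) ` spanning_trees n)"

text \<open>Points of \<open>\<real>\<^sup>N\<close> are extensional functions on the edge set, so that \<open>PiM\<close> of
  \<open>lborel\<close> over the edge set is \<open>N\<close>-dimensional Lebesgue measure.\<close>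

definition weight_simplex :: "nat \<Rightarrow> (nat set \<Rightarrow> real) \<Rightarrow> (nat set \<Rightarrow> real) set" where
  "weight_simplex n \<alpha> =
     {X \<in> complete_edges n \<rightarrow>\<^sub>E {0..}. (\<Sum>e\<in>complete_edges n. \<alpha> e * X e) \<le> real (n choose 2)}"

definition uniform_simplex :: "nat \<Rightarrow> (nat set \<Rightarrow> real) \<Rightarrow> (nat set \<Rightarrow> real) measure" where
  "uniform_simplex n \<alpha> =
     uniform_measure (Pi\<^sub>M (complete_edges n) (\<lambda>_. lborel)) (weight_simplex n \<alpha>)"

definition decomposes :: "nat \<Rightarrow> (nat set \<Rightarrow> real) \<Rightarrow> (nat \<Rightarrow> real) \<Rightarrow> bool" where
  "decomposes n \<alpha> d \<longleftrightarrow> (\<forall>v\<in>{1..n}. \<forall>w\<in>{1..n}. v \<noteq> w \<longrightarrow> \<alpha> {v, w} = d v * d w)"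

end

(*
  The minimum spanning tree weight equals the integral over p >= 0 of kappa(G_p) - 1, where G_p
  consists of the edges of weight at most p and kappa counts components (greedy algorithm).

  The weight is homogeneous of degree 1, so writing exp (- s) as an integral of indicators turns a
  uniform point of the simplex into independent exponential variables of rates alpha_e, at the cost
  of a factor N / (N + 1).  Then G_p has independent edges of probability 1 - exp (- alpha_e p).

  A vertex set S of size k is a component of G_p with probability between t p^(k-1) exp (- p d_S D)
  and t p^(k-1) exp (- p d_S (D - d_S)), where t = d_S^(k-2) prod_{v in S} d_v comes from Cayley's
  formula; both bounds follow by exploring G_p one vertex at a time.  The lower bound integrates
  exactly to the S-term of the series.  For the upper bound, when p is at most 2 omega^2 ln n / n
  there are at most n / K components larger than K = n^(1/4), and for larger p all but one of the
  components have at most n / 2 vertices, which is unlikely.  The series is at least omega^(-2),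
  so all errors are relatively small.
*)
theory Submission
  imports Defs "HOL-Probability.Probability" "HOL-Real_Asymp.Real_Asymp"
begin

section \<open>Components of a graph\<close>

text \<open>Summed over all \<open>S\<close>, the component probabilities give the mean of kappa,
  not of kappa - 1, and the missing 1 is not integrable over p >= 0. The lower bound therefore
  compares only up to p1 = n^(-1/2): the surplus costs p1, and as p1 n / omega^2 tends to infinity,
  only a vanishing fraction of the series comes from beyond p1. The two bounds on a component
  probability differ by the factor exp (p d_S^2), which integration turns into (1 - d_S/D)^(-k).
  This is near 1 only if k^2 omega^2 is small against n, so larger sets have to be handled by
  counting. The cutoff K must satisfy K^2 omega^2 = o(n) for this, and omega^4 ln n = o(K) to make
  the n / K larger components harmless; n^(1/4) does both. The endpoint 2 omega^2 ln n / n solves n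
  exp (- p n / (2 omega^2)) = 1, and beyond it the mean number of components with at most n / 2
  vertices is at most e n exp (- p n / (2 omega^2)). No trees are counted: the closed form in
  Cayley's formula is shown to satisfy the recursion of the exploration. Random graphs are finite
  weighted sums over edge sets, so independence is a rearrangement of sums.\<close>

definition edge_rel :: "'a set set \<Rightarrow> ('a \<times> 'a) set" where
  "edge_rel G = {(x, y). {x, y} \<in> G}"

definition graph_component :: "'a set \<Rightarrow> 'a set set \<Rightarrow> 'a \<Rightarrow> 'a set" where
  "graph_component V G v = {u \<in> V. (v, u) \<in> (edge_rel G)\<^sup>*}"

definition graph_components :: "'a set \<Rightarrow> 'a set set \<Rightarrow> 'a set set" where
  "graph_components V G = graph_component V G ` V"

lemma edge_rel_rtrancl_sym: "(x, y) \<in> (edge_rel G)\<^sup>* \<Longrightarrow> (y, x) \<in> (edge_rel G)\<^sup>*"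
proof -
  have "sym (edge_rel G)" by (auto simp: edge_rel_def sym_def insert_commute)
  then show "(x, y) \<in> (edge_rel G)\<^sup>* \<Longrightarrow> (y, x) \<in> (edge_rel G)\<^sup>*"
    by (meson sym_rtrancl symD)
qed

lemma edge_rel_mono: "G \<subseteq> H \<Longrightarrow> (edge_rel G)\<^sup>* \<subseteq> (edge_rel H)\<^sup>*"
  by (intro rtrancl_mono) (auto simp: edge_rel_def)

lemma edge_rel_insert: "edge_rel (insert {x, y} G) = insert (x, y) (insert (y, x) (edge_rel G))"
  by (auto simp: edge_rel_def doubleton_eq_iff)

text \<open>A walk can be shortened until it crosses the new edge at most once, in one of two
  directions. \<open>rtrancl_insert\<close> adds one directed pair, so it is applied to both
  orientations; transitivity removes the cases with two crossings.\<close>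

lemma edge_rel_rtrancl_insert:
  "(a, b) \<in> (edge_rel (insert {x, y} G))\<^sup>* \<longleftrightarrow>
     (a, b) \<in> (edge_rel G)\<^sup>* \<or>
     (a, x) \<in> (edge_rel G)\<^sup>* \<and> (y, b) \<in> (edge_rel G)\<^sup>* \<or>
     (a, y) \<in> (edge_rel G)\<^sup>* \<and> (x, b) \<in> (edge_rel G)\<^sup>*"
proof -
  note t = rtrancl_trans[of _ _ "edge_rel G"]
  have "(a, b) \<in> (edge_rel (insert {x, y} G))\<^sup>* \<longleftrightarrow>
    ((a, b) \<in> (edge_rel G)\<^sup>* \<or> (a, y) \<in> (edge_rel G)\<^sup>* \<and> (x, b) \<in> (edge_rel G)\<^sup>*) \<or>
    ((a, x) \<in> (edge_rel G)\<^sup>* \<or> (a, y) \<in> (edge_rel G)\<^sup>* \<and> (x, x) \<in> (edge_rel G)\<^sup>*) \<and>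
    ((y, b) \<in> (edge_rel G)\<^sup>* \<or> (y, y) \<in> (edge_rel G)\<^sup>* \<and> (x, b) \<in> (edge_rel G)\<^sup>*)"
    unfolding edge_rel_insert rtrancl_insert[of x y] rtrancl_insert[of y x] by blast
  then show ?thesis
    using t[of a x b] t[of a y b] by auto
qed

lemma connected_graph_iff: "connected_graph V G \<longleftrightarrow> (\<forall>u\<in>V. \<forall>v\<in>V. (u, v) \<in> (edge_rel G)\<^sup>*)"
  by (simp add: connected_graph_def edge_rel_def)

lemma component_refl: "v \<in> V \<Longrightarrow> v \<in> graph_component V G v"
  by (simp add: graph_component_def)

lemma component_eqI:
  assumes "u \<in> graph_component V G v"
  shows "graph_component V G u = graph_component V G v"
proof -
  have vu: "(v, u) \<in> (edge_rel G)\<^sup>*" using assms by (simp add: graph_component_def)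
  have "(u, b) \<in> (edge_rel G)\<^sup>* \<longleftrightarrow> (v, b) \<in> (edge_rel G)\<^sup>*" for b
    using rtrancl_trans[OF vu, of b] rtrancl_trans[OF edge_rel_rtrancl_sym[OF vu], of b] by blast
  then show ?thesis by (simp add: graph_component_def)
qed

lemma component_eq_iff:
  assumes "u \<in> V"
  shows "graph_component V G u = graph_component V G v \<longleftrightarrow> (v, u) \<in> (edge_rel G)\<^sup>*"
  using assms component_refl[OF assms, of G] component_eqI[of u V G v]
  by (auto simp: graph_component_def)

lemma finite_components: "finite V \<Longrightarrow> finite (graph_components V G)"
  by (simp add: graph_components_def)

lemma components_subset: "S \<in> graph_components V G \<Longrightarrow> S \<subseteq> V"
  by (auto simp: graph_components_def graph_component_def)

lemma components_nonempty: "S \<in> graph_components V G \<Longrightarrow> S \<noteq> {}"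
  by (auto simp: graph_components_def graph_component_def)

lemma components_disjoint: "disjoint (graph_components V G)"
proof -
  have "A = B" if "A \<in> graph_components V G" "B \<in> graph_components V G" "x \<in> A" "x \<in> B" for A B x
  proof -
    obtain a b where "A = graph_component V G a" "B = graph_component V G b"
      using \<open>A \<in> _\<close> \<open>B \<in> _\<close> unfolding graph_components_def by blast
    then show ?thesis using component_eqI[of x V G a] component_eqI[of x V G b] that(3,4) by simp
  qed
  then show ?thesis unfolding disjoint_def by blast
qed

lemma Union_components: "\<Union> (graph_components V G) = V"
proof
  show "\<Union> (graph_components V G) \<subseteq> V" using components_subset by blast
  show "V \<subseteq> \<Union> (graph_components V G)"
    by (auto simp: graph_components_def intro: component_refl)
qed

lemma sum_card_components:
  assumes "finite V"
  shows "(\<Sum>S\<in>graph_components V G. card S) = card V"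
proof -
  have "finite S" if "S \<in> graph_components V G" for S
    using components_subset[OF that] assms finite_subset by blast
  then show ?thesis
    using card_Union_disjoint[OF components_disjoint[of V G]] by (simp add: Union_components)
qed

lemma components_empty: "graph_components V {} = (\<lambda>v. {v}) ` V"
proof -
  have "graph_component V {} v = {v}" if "v \<in> V" for v
    using that by (auto simp: graph_component_def edge_rel_def)
  then show ?thesis by (auto simp: graph_components_def)
qed

lemma card_components_empty: "card (graph_components V {}) = card V"
  by (simp add: components_empty card_image)

lemma components_cong:
  "(edge_rel G)\<^sup>* = (edge_rel H)\<^sup>* \<Longrightarrow> graph_components V G = graph_components V H"
  by (simp add: graph_components_def graph_component_def)

lemma card_components_connected:
  assumes "connected_graph V G" "V \<noteq> {}"
  shows "card (graph_components V G) = 1"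
proof -
  obtain v where v: "v \<in> V" using assms by blast
  have "graph_component V G u = V" if "u \<in> V" for u
    using assms that by (auto simp: graph_component_def connected_graph_iff)
  then have "graph_components V G = {V}" using v by (auto simp: graph_components_def)
  then show ?thesis by simp
qed

lemma edge_rel_insert_connected:
  assumes "(x, y) \<in> (edge_rel G)\<^sup>*"
  shows "(edge_rel (insert {x, y} G))\<^sup>* = (edge_rel G)\<^sup>*"
proof -
  note t = rtrancl_trans[of _ _ "edge_rel G"] and xy = assms edge_rel_rtrancl_sym[OF assms]
  have "(a, b) \<in> (edge_rel (insert {x, y} G))\<^sup>* \<longleftrightarrow> (a, b) \<in> (edge_rel G)\<^sup>*" for a b
    unfolding edge_rel_rtrancl_insert using t[OF t[OF _ xy(1)], of a b] t[OF t[OF _ xy(2)], of a b]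
    by blast
  then show ?thesis by auto
qed

text \<open>The classes of \<open>x\<close> and \<open>y\<close> are replaced by their union, and
  every other class survives.\<close>

lemma card_components_insert:
  assumes "finite V" "x \<in> V" "y \<in> V" "(x, y) \<notin> (edge_rel G)\<^sup>*"
  shows "card (graph_components V G) = Suc (card (graph_components V (insert {x, y} G)))"
proof -
  let ?C = "graph_component V G" and ?D = "graph_component V (insert {x, y} G)"
  have ne: "?C x \<noteq> ?C y" using assms(4) edge_rel_rtrancl_sym[of y x G]
    by (auto simp: component_eq_iff[OF assms(2)])
  have D: "?D v = (if v \<in> ?C x \<union> ?C y then ?C x \<union> ?C y else ?C v)" if "v \<in> V" for v
  proof -
    have sym: "v \<in> ?C u \<longleftrightarrow> (v, u) \<in> (edge_rel G)\<^sup>*" for u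
      using that edge_rel_rtrancl_sym[of u v G] edge_rel_rtrancl_sym[of v u G]
      by (auto simp: graph_component_def)
    have "?D v = ?C v \<union> (if v \<in> ?C x then ?C y else {}) \<union> (if v \<in> ?C y then ?C x else {})"
      unfolding sym by (auto simp: graph_component_def edge_rel_rtrancl_insert)
    moreover have "v \<in> ?C x \<Longrightarrow> ?C v = ?C x" "v \<in> ?C y \<Longrightarrow> ?C v = ?C y"
      by (simp_all add: component_eqI)
    ultimately show ?thesis by (auto simp del: insert_iff split: if_splits)
  qed
  have eq: "graph_components V (insert {x, y} G) = insert (?C x \<union> ?C y) (graph_components V G - {?C x, ?C y})"
  proof (intro set_eqI iffI)
    fix S assume "S \<in> graph_components V (insert {x, y} G)"
    then obtain v where v: "v \<in> V" "S = ?D v" by (auto simp: graph_components_def)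
    show "S \<in> insert (?C x \<union> ?C y) (graph_components V G - {?C x, ?C y})"
      using v D[OF v(1)] component_refl[OF v(1), of G] by (auto simp: graph_components_def)
  next
    fix S assume S: "S \<in> insert (?C x \<union> ?C y) (graph_components V G - {?C x, ?C y})"
    show "S \<in> graph_components V (insert {x, y} G)"
    proof (cases "S = ?C x \<union> ?C y")
      case True
      then have "S = ?D x" using D[OF assms(2)] component_refl[OF assms(2), of G] by simp
      then show ?thesis using assms by (simp add: graph_components_def)
    next
      case False
      then obtain v where v: "v \<in> V" "S = ?C v" "?C v \<noteq> ?C x" "?C v \<noteq> ?C y"
        using S by (auto simp: graph_components_def)
      then have "v \<notin> ?C x \<union> ?C y" using component_eqI[of v V G x] component_eqI[of v V G y] by auto
      then have "S = ?D v" using D[OF v(1)] v by simp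
      then show ?thesis using v by (simp add: graph_components_def)
    qed
  qed
  \<comment> \<open>The union is not among the old classes, so inserting it really adds one to the
    cardinality.\<close>
  have "?C x \<union> ?C y \<notin> graph_components V G - {?C x, ?C y}"
  proof
    assume "?C x \<union> ?C y \<in> graph_components V G - {?C x, ?C y}"
    then obtain z where z: "?C x \<union> ?C y = ?C z" "?C z \<noteq> ?C x" by (auto simp: graph_components_def)
    then have "x \<in> ?C z" using component_refl[OF assms(2), of G] by blast
    then show False using component_eqI[of x V G z] z(2) by simp
  qed
  moreover have "card {?C x, ?C y} = 2" using ne by simp
  moreover have "{?C x, ?C y} \<subseteq> graph_components V G" using assms by (auto simp: graph_components_def)
  moreover have "card {?C x, ?C y} \<le> card (graph_components V G)"
    using calculation finite_components[OF assms(1)] by (intro card_mono) auto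
  ultimately show ?thesis unfolding eq
    using finite_components[OF assms(1), of G] by (simp add: card_Diff_subset)
qed

lemma card_components_le_insert:
  assumes "finite V" "x \<in> V" "y \<in> V"
  shows "card (graph_components V G) \<le> Suc (card (graph_components V (insert {x, y} G)))"
  using card_components_insert[OF assms] components_cong[OF edge_rel_insert_connected, of x y G V]
  by (cases "(x, y) \<in> (edge_rel G)\<^sup>*") auto

text \<open>One edge merges at most two components. With \<open>H\<close> the edges of a spanning
  tree above a threshold, this bounds their number from below.\<close>

lemma card_components_Un:
  assumes "finite V" "finite H" "\<And>e. e \<in> H \<Longrightarrow> e \<subseteq> V \<and> card e = 2"
  shows "card (graph_components V G) \<le> card H + card (graph_components V (G \<union> H))"
  using assms(2,3)
proof (induction H rule: finite_induct)
  case (insert e H)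
  obtain x y where e: "e = {x, y}" "x \<in> V" "y \<in> V"
    using insert.prems[of e] by (auto simp: card_2_iff)
  have "card (graph_components V (G \<union> H)) \<le> Suc (card (graph_components V (G \<union> insert e H)))"
    using card_components_le_insert[OF assms(1) e(2,3), of "G \<union> H"] e by simp
  then show ?case using insert by simp
qed simp

section \<open>Acyclicity and Kruskal's algorithm\<close>

lemma graph_cycle_insert:
  assumes cyc: "graph_cycle (insert {x, y} T) c" and no: "(x, y) \<notin> (edge_rel T)\<^sup>*"
  shows "graph_cycle T c"
proof (rule ccontr)
  assume "\<not> graph_cycle T c"
  define l where "l = length c"
  have l: "3 \<le> l" and dist: "distinct c"
    and ed: "\<And>i. i < l \<Longrightarrow> {c ! i, c ! (Suc i mod l)} \<in> insert {x, y} T"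
    using cyc by (auto simp: graph_cycle_def l_def)
  obtain i where i: "i < l" "{c ! i, c ! (Suc i mod l)} \<notin> T"
    using \<open>\<not> graph_cycle T c\<close> l dist by (auto simp: graph_cycle_def l_def)
  then have ixy: "{c ! i, c ! (Suc i mod l)} = {x, y}" using ed by blast
  \<comment> \<open>The new edge occupies only position \<open>i\<close> of the cycle: the vertices
    are distinct, and a second, reversed occurrence would close the cycle after two steps, against
    \<open>3 \<le> l\<close>.\<close>
  have other: "{c ! j, c ! (Suc j mod l)} \<in> T" if j: "j < l" "j \<noteq> i" for j
  proof (rule ccontr)
    assume "{c ! j, c ! (Suc j mod l)} \<notin> T"
    then have "{c ! j, c ! (Suc j mod l)} = {c ! i, c ! (Suc i mod l)}" using ed[OF j(1)] ixy by simp
    moreover have "c ! j \<noteq> c ! i" using dist j i by (simp add: nth_eq_iff_index_eq l_def)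
    ultimately have eqs: "c ! j = c ! (Suc i mod l)" "c ! (Suc j mod l) = c ! i"
      by (auto simp: doubleton_eq_iff)
    have "Suc i mod l < l" "Suc j mod l < l" using l by auto
    then have "j = Suc i mod l" "Suc j mod l = i"
      using eqs dist j i by (simp_all add: nth_eq_iff_index_eq l_def)
    then show False using l i j by (auto simp: mod_Suc split: if_splits)
  qed
  \<comment> \<open>The remaining \<open>l - 1\<close> edges of the cycle form a walk in
    \<open>T\<close> from one end of the new edge to the other.\<close>
  have "(c ! (Suc i mod l), c ! ((Suc i + m) mod l)) \<in> (edge_rel T)\<^sup>*" if "m < l" for m
    using that
  proof (induction m)
    case (Suc m)
    let ?j = "(Suc i + m) mod l"
    have "?j \<noteq> i"
    proof
      assume "?j = i"
      then show False using Suc.prems i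
        by (cases "Suc i + m < l") (auto simp: mod_if[of "Suc i + m" l] simp del: add_Suc)
    qed
    then have "{c ! ?j, c ! (Suc ?j mod l)} \<in> T" using other l by simp
    moreover have "Suc ?j mod l = (Suc i + Suc m) mod l" by (simp add: mod_Suc_eq)
    ultimately have "(c ! ?j, c ! ((Suc i + Suc m) mod l)) \<in> edge_rel T" by (simp add: edge_rel_def)
    then show ?case using Suc by (meson Suc_lessD rtrancl.rtrancl_into_rtrancl)
  qed simp
  from this[of "l - 1"] have "(c ! (Suc i mod l), c ! i) \<in> (edge_rel T)\<^sup>*"
    using l i by simp
  moreover have "c ! (Suc i mod l) = x \<and> c ! i = y \<or> c ! (Suc i mod l) = y \<and> c ! i = x"
    using ixy by (auto simp: doubleton_eq_iff)
  ultimately show False using no edge_rel_rtrancl_sym[of y x T] by auto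
qed

text \<open>The list is scanned in order, and an edge is kept when its ends are not yet connected.
  The invariant is required for every prefix because the threshold graphs of a list sorted by weight
  are prefixes.\<close>

lemma kruskal:
  assumes V: "finite V" and es: "distinct es" "\<And>e. e \<in> set es \<Longrightarrow> e \<subseteq> V \<and> card e = 2"
  shows "\<exists>T \<subseteq> set es. (\<nexists>c. graph_cycle T c) \<and>
    (\<forall>k\<le>length es. (edge_rel (T \<inter> set (take k es)))\<^sup>* = (edge_rel (set (take k es)))\<^sup>* \<and>
       card (T \<inter> set (take k es)) + card (graph_components V (set (take k es))) = card V)"
  using es
proof (induction es rule: rev_induct)
  case Nil
  have "\<not> graph_cycle {} c" for c :: "'a list" by (auto simp: graph_cycle_def intro!: exI[of _ 0])
  then show ?case by (simp add: card_components_empty)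
next
  case (snoc e es)
  obtain T where T: "T \<subseteq> set es" "\<nexists>c. graph_cycle T c"
    "\<And>k. k \<le> length es \<Longrightarrow> (edge_rel (T \<inter> set (take k es)))\<^sup>* = (edge_rel (set (take k es)))\<^sup>*"
    "\<And>k. k \<le> length es \<Longrightarrow> card (T \<inter> set (take k es)) + card (graph_components V (set (take k es))) = card V"
    using snoc by auto
  obtain x y where e: "e = {x, y}" "x \<in> V" "y \<in> V"
    using snoc.prems(2)[of e] by (auto simp: card_2_iff)
  have e_new: "e \<notin> set es" using snoc.prems by simp
  have full: "(edge_rel T)\<^sup>* = (edge_rel (set es))\<^sup>*" "card T + card (graph_components V (set es)) = card V"
    using T(3,4)[of "length es"] T(1) by (simp_all add: Int_absorb2)
  have fin: "finite T" using T(1) finite_subset by blast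
  \<comment> \<open>Shorter prefixes do not see \<open>e\<close>, so only the full list has to be
    checked for the enlarged forest.\<close>
  have *: "?case" if T': "T' \<subseteq> set (es @ [e])" "T' \<inter> set es = T" "\<nexists>c. graph_cycle T' c"
    "(edge_rel T')\<^sup>* = (edge_rel (set (es @ [e])))\<^sup>*"
    "card T' + card (graph_components V (set (es @ [e]))) = card V" for T'
  proof (intro exI[of _ T'] conjI allI impI)
    fix k assume k: "k \<le> length (es @ [e])"
    show "(edge_rel (T' \<inter> set (take k (es @ [e]))))\<^sup>* = (edge_rel (set (take k (es @ [e]))))\<^sup>*"
      "card (T' \<inter> set (take k (es @ [e]))) + card (graph_components V (set (take k (es @ [e])))) = card V"
    proof -
      consider "k = length (es @ [e])" | "k \<le> length es" using k by fastforce
      then have "(edge_rel (T' \<inter> set (take k (es @ [e]))))\<^sup>* = (edge_rel (set (take k (es @ [e]))))\<^sup>* \<and>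
        card (T' \<inter> set (take k (es @ [e]))) + card (graph_components V (set (take k (es @ [e])))) = card V"
      proof cases
        case 1
        then show ?thesis using T' by (simp add: Int_absorb2)
      next
        case 2
        then have "T' \<inter> set (take k es) = T \<inter> set (take k es)"
          using T'(2) set_take_subset[of k es] by blast
        then show ?thesis using 2 T(3,4)[of k] by simp
      qed
      then show "(edge_rel (T' \<inter> set (take k (es @ [e]))))\<^sup>* = (edge_rel (set (take k (es @ [e]))))\<^sup>*"
        "card (T' \<inter> set (take k (es @ [e]))) + card (graph_components V (set (take k (es @ [e])))) = card V"
        by auto
    qed
  qed (use T' in auto)
  show ?case
  proof (cases "(x, y) \<in> (edge_rel T)\<^sup>*")
    case True
    have 1: "(edge_rel (set (es @ [e])))\<^sup>* = (edge_rel (set es))\<^sup>*"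
      using edge_rel_insert_connected[of x y "set es"] True e full by simp
    show ?thesis
      using T 1 full components_cong[OF 1] by (intro *[of T]) auto
  next
    case False
    have 1: "(edge_rel (insert e T))\<^sup>* = (edge_rel (set (es @ [e])))\<^sup>*"
      by (auto simp: e edge_rel_rtrancl_insert full(1))
    have "card (graph_components V (set es)) = Suc (card (graph_components V (set (es @ [e]))))"
      using card_components_insert[OF V e(2,3), of "set es"] False full e by simp
    moreover have "e \<notin> T" using e_new T(1) by blast
    moreover from this have "card (insert e T) = Suc (card T)" using fin by simp
    ultimately have 2: "card (insert e T) + card (graph_components V (set (es @ [e]))) = card V"
      using full by simp
    have "\<nexists>c. graph_cycle (insert e T) c"
      using graph_cycle_insert False T(2) e by metis
    then show ?thesis using 1 2 T(1) e_new by (intro *[of "insert e T"]) auto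
  qed
qed

section \<open>The greedy spanning tree\<close>

lemma finite_complete_edges: "finite (complete_edges n)"
  by (rule finite_subset[of _ "Pow {1..n}"]) (auto simp: complete_edges_def)

lemma complete_edges_card: "card (complete_edges n) = n choose 2"
  using n_subsets[of "{1..n}" 2] by (simp add: complete_edges_def)

lemma finite_spanning_trees: "finite (spanning_trees n)"
  by (rule finite_subset[of _ "Pow (complete_edges n)"])
    (auto simp: spanning_trees_def finite_complete_edges)

lemma connected_complete_graph: "connected_graph {1..n} (complete_edges n)"
  unfolding connected_graph_iff
proof (intro ballI)
  fix u v assume uv: "u \<in> {1..n}" "v \<in> {1..n}"
  show "(u, v) \<in> (edge_rel (complete_edges n))\<^sup>*"
  proof (cases "u = v")
    case False
    then show ?thesis using uv
      by (intro r_into_rtrancl) (auto simp: edge_rel_def complete_edges_def)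
  qed simp
qed

section \<open>Spanning tree weights as integrals over thresholds\<close>

lemma ennreal_sum_eq_nn_integral_card:
  assumes "finite T" "\<And>e. e \<in> T \<Longrightarrow> 0 \<le> X e"
  shows "ennreal (\<Sum>e\<in>T. X e) =
    (\<integral>\<^sup>+p. indicator {0..} p * ennreal (real (card {e\<in>T. p < X e})) \<partial>lborel)"
proof -
  have "ennreal (\<Sum>e\<in>T. X e) = (\<Sum>e\<in>T. \<integral>\<^sup>+p. indicator {0..<X e} p \<partial>lborel)"
    using assms by (simp add: sum_ennreal)
  also have "\<dots> = (\<integral>\<^sup>+p. (\<Sum>e\<in>T. indicator {0..<X e} p) \<partial>lborel)"
    by (rule nn_integral_sum[symmetric]) simp
  also have "\<dots> = (\<integral>\<^sup>+p. indicator {0..} p * ennreal (real (card {e\<in>T. p < X e})) \<partial>lborel)"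
  proof (intro nn_integral_cong)
    fix p :: real
    have "(\<Sum>e\<in>T. indicator {0..<X e} p) = (\<Sum>e\<in>T. if p < X e then indicator {0..} p else (0::ennreal))"
      by (intro sum.cong) (auto simp: indicator_def)
    also have "\<dots> = indicator {0..} p * ennreal (real (card {e\<in>T. p < X e}))"
      using assms(1) by (simp add: sum.If_cases Int_def ennreal_of_nat_eq_real_of_nat mult.commute)
    finally show "(\<Sum>e\<in>T. indicator {0..<X e} p) = indicator {0..} p * ennreal (real (card {e\<in>T. p < X e}))" .
  qed
  finally show ?thesis .
qed

text \<open>Truncated subtraction is harmless here: for \<open>n \<ge> 1\<close> there is at least one component.\<close>

definition excess_components :: "nat \<Rightarrow> nat set set \<Rightarrow> nat" where
  "excess_components n G = card (graph_components {1..n} G) - 1"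

text \<open>The threshold graph together with the tree edges above \<open>p\<close> contains the
  whole tree, hence is connected, and each added edge removes at most one component.\<close>

lemma excess_components_le_spanning_tree:
  assumes "1 \<le> n" "T \<in> spanning_trees n"
  shows "excess_components n {e\<in>complete_edges n. X e \<le> (p :: real)} \<le> card {e\<in>T. p < X e}"
proof -
  let ?G = "{e\<in>complete_edges n. X e \<le> p}" and ?H = "{e\<in>T. p < X e}"
  have T: "T \<subseteq> complete_edges n" "connected_graph {1..n} T"
    using assms by (auto simp: spanning_trees_def)
  have "card (graph_components {1..n} ?G) \<le> card ?H + card (graph_components {1..n} (?G \<union> ?H))"
    using T finite_subset[OF T(1) finite_complete_edges]
    by (intro card_components_Un) (auto simp: complete_edges_def)
  moreover have "T \<subseteq> ?G \<union> ?H" using T by auto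
  then have "connected_graph {1..n} (?G \<union> ?H)"
    using T(2) edge_rel_mono[of T "?G \<union> ?H"] unfolding connected_graph_iff by blast
  then have "card (graph_components {1..n} (?G \<union> ?H)) = 1"
    using assms(1) by (intro card_components_connected) auto
  ultimately show ?thesis by (simp add: excess_components_def)
qed

lemma filter_le_eq_takeWhile:
  "sorted (map f xs) \<Longrightarrow> filter (\<lambda>x. f x \<le> (p :: 'a :: linorder)) xs = takeWhile (\<lambda>x. f x \<le> p) xs"
proof (induction xs)
  case (Cons a xs)
  show ?case
  proof (cases "f a \<le> p")
    case False
    then show ?thesis using Cons.prems by (auto simp: filter_empty_conv dest: order_trans)
  qed (use Cons in simp)
qed simp

text \<open>A single tree attains equality at all thresholds at once; this turns the lower bound
  valid for every spanning tree into an identity for the minimum.\<close>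

lemma greedy_spanning_tree:
  assumes n: "1 \<le> n"
  obtains T where "T \<in> spanning_trees n"
    "\<And>p. excess_components n {e\<in>complete_edges n. X e \<le> p} = card {e\<in>T. p < (X e :: real)}"
proof -
  let ?E = "complete_edges n"
  obtain xs where xs: "set xs = ?E" "distinct xs"
    using finite_distinct_list[OF finite_complete_edges] by blast
  define es where "es = sort_key X xs"
  have es: "set es = ?E" "distinct es" "sorted (map X es)" using xs by (auto simp: es_def)
  have "\<And>e. e \<in> set es \<Longrightarrow> e \<subseteq> {1..n} \<and> card e = 2"
    unfolding es(1) by (auto simp: complete_edges_def)
  from kruskal[OF finite_atLeastAtMost es(2) this]
  obtain T where T: "T \<subseteq> ?E" "\<nexists>c. graph_cycle T c" and
    Tk: "\<And>k. k \<le> length es \<Longrightarrow> (edge_rel (T \<inter> set (take k es)))\<^sup>* = (edge_rel (set (take k es)))\<^sup>*"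
      "\<And>k. k \<le> length es \<Longrightarrow>
         card (T \<inter> set (take k es)) + card (graph_components {1..n} (set (take k es))) = card {1..n}"
    unfolding es(1) by blast
  have fin: "finite T" using T(1) finite_complete_edges finite_subset by blast
  have "(edge_rel T)\<^sup>* = (edge_rel ?E)\<^sup>*"
    using Tk(1)[of "length es"] T(1) es(1) by (simp add: Int_absorb2)
  then have "connected_graph {1..n} T"
    using connected_complete_graph[of n] by (simp add: connected_graph_iff)
  then have span: "T \<in> spanning_trees n" using T by (simp add: spanning_trees_def)
  have "card (graph_components {1..n} ?E) = 1"
    using connected_complete_graph n by (intro card_components_connected) auto
  then have cardT: "card T + 1 = n"
    using Tk(2)[of "length es"] T(1) es(1) by (simp add: Int_absorb2)
  have "excess_components n {e\<in>?E. X e \<le> p} = card {e\<in>T. p < X e}" for p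
  proof -
    define k where "k = length (takeWhile (\<lambda>e. X e \<le> p) es)"
    have k: "k \<le> length es" by (simp add: k_def length_takeWhile_le)
    \<comment> \<open>Sorting by weight makes the threshold graph an initial segment, ties
      included.\<close>
    have "take k es = filter (\<lambda>e. X e \<le> p) es"
      using es(3) by (simp add: k_def takeWhile_eq_take[symmetric] filter_le_eq_takeWhile)
    then have G: "set (take k es) = {e\<in>?E. X e \<le> p}" using es(1) by auto
    have "card (T \<inter> {e\<in>?E. X e \<le> p}) + card (graph_components {1..n} {e\<in>?E. X e \<le> p}) = n"
      using Tk(2)[OF k] by (simp add: G)
    moreover have "card T = card (T \<inter> {e\<in>?E. X e \<le> p}) + card {e\<in>T. p < X e}"
      using fin T(1) by (subst card_Un_disjoint[symmetric]) (auto intro!: arg_cong[of _ _ card])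
    ultimately show ?thesis using cardT by (simp add: excess_components_def)
  qed
  with span that show ?thesis by blast
qed

text \<open>Minimality is read off the integrands instead of an exchange argument: for every
  \<open>p\<close> the greedy tree has the fewest edges above \<open>p\<close>.\<close>

lemma mst_weight_attained:
  assumes "1 \<le> n" "\<And>e. e \<in> complete_edges n \<Longrightarrow> 0 \<le> X e"
  shows "0 \<le> mst_weight n X"
    and "ennreal (mst_weight n X) =
      (\<integral>\<^sup>+p. indicator {0..} p * ennreal (real (excess_components n {e\<in>complete_edges n. X e \<le> p})) \<partial>lborel)"
      (is "_ = ?I")
proof -
  obtain T where T: "T \<in> spanning_trees n"
    "\<And>p. excess_components n {e\<in>complete_edges n. X e \<le> p} = card {e\<in>T. p < X e}"
    using greedy_spanning_tree[OF assms(1)] by metis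
  have sub: "S \<subseteq> complete_edges n" if "S \<in> spanning_trees n" for S
    using that by (auto simp: spanning_trees_def)
  have W: "ennreal (\<Sum>e\<in>S. X e) =
    (\<integral>\<^sup>+p. indicator {0..} p * ennreal (real (card {e\<in>S. p < X e})) \<partial>lborel)"
    if "S \<in> spanning_trees n" for S
    using sub[OF that] assms(2) finite_subset[OF sub[OF that] finite_complete_edges]
    by (intro ennreal_sum_eq_nn_integral_card) auto
  have nonneg: "0 \<le> (\<Sum>e\<in>S. X e)" if "S \<in> spanning_trees n" for S
    using sub[OF that] assms(2) by (intro sum_nonneg) auto
  have I: "ennreal (\<Sum>e\<in>T. X e) = ?I" using W[OF T(1)] T(2) by simp
  have "(\<Sum>e\<in>T. X e) \<le> (\<Sum>e\<in>S. X e)" if S: "S \<in> spanning_trees n" for S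
  proof -
    have "ennreal (\<Sum>e\<in>T. X e) \<le> ennreal (\<Sum>e\<in>S. X e)"
      unfolding I W[OF S] using excess_components_le_spanning_tree[OF assms(1) S, of X]
      by (intro nn_integral_mono mult_left_mono) (auto intro!: ennreal_leI)
    then show ?thesis using nonneg[OF S] by simp
  qed
  then have "mst_weight n X = (\<Sum>e\<in>T. X e)"
    unfolding mst_weight_def using T(1) finite_spanning_trees by (intro Min_eqI) auto
  then show "0 \<le> mst_weight n X" "ennreal (mst_weight n X) = ?I" using I nonneg[OF T(1)] by auto
qed

section \<open>From the simplex to exponential weights\<close>

interpretation lborel_product: product_sigma_finite "\<lambda>_. lborel :: real measure"
  by standard

lemma emeasure_lborel_scale:
  fixes t :: real
  assumes "0 < t" "A \<in> sets lborel"
  shows "ennreal t * emeasure lborel ((*) t -` A) = emeasure lborel A"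
proof -
  have m: "(*) t -` A \<in> sets lborel"
    using measurable_sets[of "(*) t" borel borel A] assms(2) by simp
  have "emeasure lborel A = (\<integral>\<^sup>+x. indicator A x \<partial>lborel)"
    using assms by simp
  also have "\<dots> = ennreal t * (\<integral>\<^sup>+x. indicator A (0 + t * x) \<partial>lborel)"
    using assms by (subst nn_integral_real_affine[of _ t 0]) auto
  also have "(\<integral>\<^sup>+x. indicator A (0 + t * x) \<partial>lborel) = (\<integral>\<^sup>+x. indicator ((*) t -` A) x \<partial>lborel)"
    by (intro nn_integral_cong) (simp add: indicator_def)
  finally show ?thesis using m by simp
qed

text \<open>The image of Lebesgue measure under scaling, reweighted by \<open>t ^ card E\<close>,
  agrees with Lebesgue measure on boxes, which determine it.\<close>

lemma nn_integral_PiM_lborel_scale: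
  assumes E: "finite E" and t: "0 < (t :: real)"
    and g: "g \<in> borel_measurable (Pi\<^sub>M E (\<lambda>_. lborel))"
  shows "(\<integral>\<^sup>+X. g X \<partial>Pi\<^sub>M E (\<lambda>_. lborel)) =
    ennreal (t ^ card E) * (\<integral>\<^sup>+X. g (\<lambda>e\<in>E. t * X e) \<partial>Pi\<^sub>M E (\<lambda>_. lborel))"
proof -
  let ?M = "Pi\<^sub>M E (\<lambda>_. lborel :: real measure)" and ?s = "\<lambda>X. \<lambda>e\<in>E. t * X e"
  have s: "?s \<in> measurable ?M ?M"
    by (intro measurable_restrict) (auto intro!: measurable_component_singleton borel_measurable_times)
  define P where "P = density (distr ?M ?M ?s) (\<lambda>_. ennreal (t ^ card E))"
  have "P = ?M"
  proof (rule lborel_product.PiM_eqI[OF E])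
    show "sets P = sets ?M" by (simp add: P_def)
    fix A :: "_ \<Rightarrow> real set" assume A: "\<And>e. e \<in> E \<Longrightarrow> A e \<in> sets lborel"
    have PA: "Pi\<^sub>E E A \<in> sets ?M" using A E by (intro sets_PiM_I_finite) auto
    have m: "(*) t -` A e \<in> sets lborel" if "e \<in> E" for e
      using measurable_sets[of "(*) t" borel borel "A e"] A[OF that] by simp
    have "?s -` Pi\<^sub>E E A \<inter> space ?M = Pi\<^sub>E E (\<lambda>e. (*) t -` A e)"
      by (auto simp: space_PiM PiE_iff)
    then have "emeasure P (Pi\<^sub>E E A) = ennreal (t ^ card E) * emeasure ?M (Pi\<^sub>E E (\<lambda>e. (*) t -` A e))"
      using PA s by (simp add: P_def emeasure_density nn_integral_cmult emeasure_distr)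
    also have "\<dots> = ennreal (t ^ card E) * (\<Prod>e\<in>E. emeasure lborel ((*) t -` A e))"
      using m E by (subst lborel_product.emeasure_PiM) auto
    also have "\<dots> = (\<Prod>e\<in>E. ennreal t * emeasure lborel ((*) t -` A e))"
      using t by (simp add: prod.distrib ennreal_power)
    also have "\<dots> = (\<Prod>e\<in>E. emeasure lborel (A e))"
      using A t by (intro prod.cong refl emeasure_lborel_scale) auto
    finally show "emeasure P (Pi\<^sub>E E A) = (\<Prod>e\<in>E. emeasure lborel (A e))" .
  qed
  then have "(\<integral>\<^sup>+X. g X \<partial>?M) = (\<integral>\<^sup>+X. g X \<partial>P)" by (rule arg_cong[OF sym])
  also have "\<dots> = (\<integral>\<^sup>+X. ennreal (t ^ card E) * g X \<partial>distr ?M ?M ?s)"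
    unfolding P_def using g by (intro nn_integral_density) auto
  also have "\<dots> = (\<integral>\<^sup>+X. ennreal (t ^ card E) * g (?s X) \<partial>?M)"
    using g by (intro nn_integral_distr[OF s]) auto
  also have "\<dots> = ennreal (t ^ card E) * (\<integral>\<^sup>+X. g (?s X) \<partial>?M)"
    using g s by (intro nn_integral_cmult) (auto intro: measurable_compose)
  finally show ?thesis .
qed

text \<open>Scaling maps the unit simplex onto the one at level \<open>t\<close>: volume contributes
  the exponent \<open>card E\<close>, homogeneity of \<open>h\<close> the exponent \<open>m\<close>.
  The cases needed later are \<open>m = 0\<close> for the volume and \<open>m = 1\<close> for the
  tree weight.\<close>

lemma nn_integral_simplex_scale:
  fixes h :: "('e \<Rightarrow> real) \<Rightarrow> ennreal"
  assumes E: "finite E" and t: "0 < t"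
    and h: "h \<in> borel_measurable (Pi\<^sub>M E (\<lambda>_. lborel))"
    and hom: "\<And>X. h (\<lambda>e\<in>E. t * X e) = ennreal (t ^ m) * h X"
  shows "(\<integral>\<^sup>+X. h X * indicator {X \<in> E \<rightarrow>\<^sub>E {0..}. (\<Sum>e\<in>E. \<alpha> e * X e) \<le> t} X \<partial>Pi\<^sub>M E (\<lambda>_. lborel)) =
    ennreal (t ^ (card E + m)) *
    (\<integral>\<^sup>+X. h X * indicator {X \<in> E \<rightarrow>\<^sub>E {0..}. (\<Sum>e\<in>E. \<alpha> e * X e) \<le> 1} X \<partial>Pi\<^sub>M E (\<lambda>_. lborel))"
proof -
  let ?M = "Pi\<^sub>M E (\<lambda>_. lborel :: real measure)"
  let ?S = "\<lambda>t. {X \<in> E \<rightarrow>\<^sub>E {0..}. (\<Sum>e\<in>E. \<alpha> e * X e) \<le> t}"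
  have ortho: "E \<rightarrow>\<^sub>E {0..} \<in> sets ?M" using E by (intro sets_PiM_I_finite) auto
  have meas: "?S s \<in> sets ?M" for s
  proof -
    have "?S s = (E \<rightarrow>\<^sub>E {0..}) \<inter> {X \<in> space ?M. (\<Sum>e\<in>E. \<alpha> e * X e) \<le> s}"
      by (auto simp: space_PiM PiE_iff extensional_def)
    also have "\<dots> \<in> sets ?M" using ortho by (rule sets.Int) measurable
    finally show ?thesis .
  qed
  have ind: "indicator (?S t) (\<lambda>e\<in>E. t * X e) = (indicator (?S 1) X :: ennreal)" if "X \<in> space ?M" for X
  proof -
    have "(\<Sum>e\<in>E. \<alpha> e * (\<lambda>e\<in>E. t * X e) e) = t * (\<Sum>e\<in>E. \<alpha> e * X e)"
      by (simp add: sum_distrib_left mult.left_commute)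
    then have "(\<Sum>e\<in>E. \<alpha> e * (\<lambda>e\<in>E. t * X e) e) \<le> t \<longleftrightarrow> (\<Sum>e\<in>E. \<alpha> e * X e) \<le> 1"
      using t by simp
    moreover have "(\<lambda>e\<in>E. t * X e) \<in> E \<rightarrow>\<^sub>E {0..} \<longleftrightarrow> X \<in> E \<rightarrow>\<^sub>E {0..}"
      using that t by (auto simp: space_PiM PiE_iff zero_le_mult_iff)
    ultimately show ?thesis by (simp add: indicator_def)
  qed
  have "(\<integral>\<^sup>+X. h X * indicator (?S t) X \<partial>?M) =
    ennreal (t ^ card E) * (\<integral>\<^sup>+X. h (\<lambda>e\<in>E. t * X e) * indicator (?S t) (\<lambda>e\<in>E. t * X e) \<partial>?M)"
    using h meas by (intro nn_integral_PiM_lborel_scale[OF E t]) auto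
  also have "(\<integral>\<^sup>+X. h (\<lambda>e\<in>E. t * X e) * indicator (?S t) (\<lambda>e\<in>E. t * X e) \<partial>?M) =
    (\<integral>\<^sup>+X. ennreal (t ^ m) * (h X * indicator (?S 1) X) \<partial>?M)"
    by (intro nn_integral_cong) (simp only: hom ind mult.assoc)
  also have "\<dots> = ennreal (t ^ m) * (\<integral>\<^sup>+X. h X * indicator (?S 1) X \<partial>?M)"
    using h meas by (intro nn_integral_cmult) auto
  finally show ?thesis
    using t by (simp add: power_add ennreal_mult mult.assoc)
qed

lemma nn_integral_exp_Ici:
  assumes "0 < (a :: real)" "0 \<le> p"
  shows "(\<integral>\<^sup>+x. ennreal (exp (- (a * x))) * indicator {p..} x \<partial>lborel) = ennreal (exp (- (a * p)) / a)"
proof -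
  have "(\<integral>\<^sup>+x. ennreal (exp (- (a * x))) * indicator {p..} x \<partial>lborel) =
    ennreal (0 - (- exp (- (a * p)) / a))"
  proof (rule nn_integral_FTC_atLeast)
    show "((\<lambda>x. - exp (- (a * x)) / a) \<longlongrightarrow> 0) at_top"
      using assms(1) by real_asymp
  qed (use assms in \<open>auto intro!: derivative_eq_intros\<close>)
  then show ?thesis by simp
qed

lemma nn_integral_exp_Icc:
  assumes "0 < (a :: real)" "0 \<le> p"
  shows "(\<integral>\<^sup>+x. ennreal (exp (- (a * x))) * indicator {0..p} x \<partial>lborel) = ennreal ((1 - exp (- (a * p))) / a)"
proof -
  have "(\<integral>\<^sup>+x. ennreal (exp (- (a * x))) * indicator {0..p} x \<partial>lborel) =
    ennreal (- exp (- (a * p)) / a - (- exp (- (a * 0)) / a))"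
    using assms by (intro nn_integral_FTC_Icc) (auto intro!: derivative_eq_intros)
  then show ?thesis by (simp add: diff_divide_distrib)
qed

text \<open>Layer cake: \<open>exp (- s)\<close> is the integral of \<open>exp (- t)\<close> over \<open>t \<ge> s\<close>, which turns the
  exponential weight into a mixture of simplices.\<close>

lemma nn_integral_exp_weight_eq_simplex:
  fixes h :: "('e \<Rightarrow> real) \<Rightarrow> ennreal"
  assumes E: "finite E" and \<alpha>: "\<And>e. e \<in> E \<Longrightarrow> 0 < \<alpha> e"
    and h: "h \<in> borel_measurable (Pi\<^sub>M E (\<lambda>_. lborel))"
    and hom: "\<And>X t. 0 < t \<Longrightarrow> h (\<lambda>e\<in>E. t * X e) = ennreal (t ^ m) * h X"
  shows "(\<integral>\<^sup>+X. h X * ennreal (exp (- (\<Sum>e\<in>E. \<alpha> e * X e))) * indicator (E \<rightarrow>\<^sub>E {0..}) X \<partial>Pi\<^sub>M E (\<lambda>_. lborel)) =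
    fact (card E + m) *
    (\<integral>\<^sup>+X. h X * indicator {X \<in> E \<rightarrow>\<^sub>E {0..}. (\<Sum>e\<in>E. \<alpha> e * X e) \<le> 1} X \<partial>Pi\<^sub>M E (\<lambda>_. lborel))"
    (is "?L = _ * ?H")
proof -
  let ?M = "Pi\<^sub>M E (\<lambda>_. lborel :: real measure)"
  let ?s = "\<lambda>X. \<Sum>e\<in>E. \<alpha> e * X e"
  interpret M: finite_product_sigma_finite "\<lambda>_. lborel :: real measure" E
    by standard (rule E)
  interpret P: pair_sigma_finite ?M "lborel :: real measure" by standard
  have ortho[measurable]: "E \<rightarrow>\<^sub>E {0..} \<in> sets ?M" using E by (intro sets_PiM_I_finite) auto
  note h[measurable]
  have s0: "0 \<le> ?s X" if "X \<in> E \<rightarrow>\<^sub>E {0..}" for X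
    using that \<alpha> by (intro sum_nonneg mult_nonneg_nonneg) (auto simp: PiE_iff intro: less_imp_le)
  have "?L = (\<integral>\<^sup>+X. (\<integral>\<^sup>+t. h X * indicator (E \<rightarrow>\<^sub>E {0..}) X *
      (ennreal (exp (- t)) * indicator {u. ?s X \<le> u} t) \<partial>lborel) \<partial>?M)"
  proof (intro nn_integral_cong)
    fix X assume "X \<in> space ?M"
    show "h X * ennreal (exp (- ?s X)) * indicator (E \<rightarrow>\<^sub>E {0..}) X =
      (\<integral>\<^sup>+t. h X * indicator (E \<rightarrow>\<^sub>E {0..}) X * (ennreal (exp (- t)) * indicator {u. ?s X \<le> u} t) \<partial>lborel)"
    proof (cases "X \<in> E \<rightarrow>\<^sub>E {0..}")
      case True
      have "(\<integral>\<^sup>+t. ennreal (exp (- t)) * indicator {?s X..} t \<partial>lborel) = ennreal (exp (- ?s X))"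
        using nn_integral_exp_Ici[of 1 "?s X"] s0[OF True] by simp
      then show ?thesis using True
        by (subst nn_integral_cmult) (simp_all add: atLeast_def)
    qed simp
  qed
  also have "\<dots> = (\<integral>\<^sup>+t. (\<integral>\<^sup>+X. h X * indicator (E \<rightarrow>\<^sub>E {0..}) X *
      (ennreal (exp (- t)) * indicator {u. ?s X \<le> u} t) \<partial>?M) \<partial>lborel)"
    by (rule P.Fubini'[symmetric]) (simp add: indicator_def split_beta', measurable)
  also have "\<dots> = (\<integral>\<^sup>+t. ennreal (t ^ (card E + m) * exp (- t)) * indicator {0..} t * ?H \<partial>lborel)"
  proof (rule nn_integral_cong_AE)
    have "AE t in lborel. t \<noteq> (0 :: real)" by (rule AE_lborel_singleton)
    then show "AE t in lborel. (\<integral>\<^sup>+X. h X * indicator (E \<rightarrow>\<^sub>E {0..}) X *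
      (ennreal (exp (- t)) * indicator {u. ?s X \<le> u} t) \<partial>?M) =
      ennreal (t ^ (card E + m) * exp (- t)) * indicator {0..} t * ?H"
    proof eventually_elim
      fix t :: real assume "t \<noteq> 0"
      show "(\<integral>\<^sup>+X. h X * indicator (E \<rightarrow>\<^sub>E {0..}) X *
        (ennreal (exp (- t)) * indicator {u. ?s X \<le> u} t) \<partial>?M) =
        ennreal (t ^ (card E + m) * exp (- t)) * indicator {0..} t * ?H"
      \<comment> \<open>For negative \<open>t\<close> everything vanishes, because the linear form
        is nonnegative on the orthant.\<close>
      proof (cases "t < 0")
        case True
        have "(\<integral>\<^sup>+X. h X * indicator (E \<rightarrow>\<^sub>E {0..}) X *
          (ennreal (exp (- t)) * indicator {u. ?s X \<le> u} t) \<partial>?M) = (\<integral>\<^sup>+X. 0 \<partial>?M)"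
        proof (intro nn_integral_cong)
          fix X
          show "h X * indicator (E \<rightarrow>\<^sub>E {0..}) X * (ennreal (exp (- t)) * indicator {u. ?s X \<le> u} t) = 0"
            using s0[of X] True by (auto simp: indicator_def)
        qed
        then show ?thesis using True by simp
      next
        case False
        then have t: "0 < t" using \<open>t \<noteq> 0\<close> by simp
        have [measurable]: "{X \<in> E \<rightarrow>\<^sub>E {0..}. ?s X \<le> t} \<in> sets ?M"
        proof -
          have "{X \<in> E \<rightarrow>\<^sub>E {0..}. ?s X \<le> t} = (E \<rightarrow>\<^sub>E {0..}) \<inter> {X \<in> space ?M. ?s X \<le> t}"
            by (auto simp: space_PiM PiE_iff extensional_def)
          also have "\<dots> \<in> sets ?M" using ortho by (rule sets.Int) measurable
          finally show ?thesis .
        qed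
        have "(\<integral>\<^sup>+X. h X * indicator (E \<rightarrow>\<^sub>E {0..}) X *
          (ennreal (exp (- t)) * indicator {u. ?s X \<le> u} t) \<partial>?M) =
          (\<integral>\<^sup>+X. ennreal (exp (- t)) * (h X * indicator {X \<in> E \<rightarrow>\<^sub>E {0..}. ?s X \<le> t} X) \<partial>?M)"
          by (intro nn_integral_cong) (auto simp: indicator_def ac_simps)
        also have "\<dots> = ennreal (exp (- t)) * (ennreal (t ^ (card E + m)) * ?H)"
          using nn_integral_simplex_scale[OF E t h hom[OF t], of \<alpha>] by (subst nn_integral_cmult) auto
        also have "\<dots> = ennreal (t ^ (card E + m) * exp (- t)) * indicator {0..} t * ?H"
          using t by (simp add: ennreal_mult ac_simps)
        finally show ?thesis .
      qed
    qed
  qed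
  also have "\<dots> = (\<integral>\<^sup>+t. ennreal (t ^ (card E + m) * exp (- t)) * indicator {0..} t \<partial>lborel) * ?H"
    by (rule nn_integral_multc) simp
  also have "(\<integral>\<^sup>+t. ennreal (t ^ (card E + m) * exp (- t)) * indicator {0..} t \<partial>lborel) =
    fact (card E + m)"
    using nn_intergal_power_times_exp_Ici[of "card E + m"] by (simp add: ennreal_fact[symmetric])
  finally show ?thesis by simp
qed

section \<open>Independent exponential weights and their threshold graphs\<close>

definition graph_weight :: "('e \<Rightarrow> real) \<Rightarrow> 'e set \<Rightarrow> 'e set \<Rightarrow> real" where
  "graph_weight q E G = (\<Prod>e\<in>E. if e \<in> G then q e else 1 - q e)"

lemma indicator_PiE_eq_prod:
  assumes "finite E" "X \<in> extensional E"
  shows "indicator (Pi\<^sub>E E A) X = (\<Prod>e\<in>E. indicator (A e) (X e) :: ennreal)"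
proof (cases "\<forall>e\<in>E. X e \<in> A e")
  case True
  then show ?thesis using assms by (simp add: PiE_iff)
next
  case False
  then obtain e where "e \<in> E" "X e \<notin> A e" by blast
  then have "(\<Prod>e\<in>E. indicator (A e) (X e) :: ennreal) = 0"
    using assms by (intro prod_zero) (auto intro!: bexI[of _ e])
  moreover have "X \<notin> Pi\<^sub>E E A" using False by (simp add: PiE_iff)
  ultimately show ?thesis by simp
qed

lemma nn_integral_exp_weight_box:
  assumes E: "finite E" and A: "\<And>e. e \<in> E \<Longrightarrow> A e \<in> sets borel"
  shows "(\<integral>\<^sup>+X. ennreal (exp (- (\<Sum>e\<in>E. \<alpha> e * X e))) * indicator (Pi\<^sub>E E A) X \<partial>Pi\<^sub>M E (\<lambda>_. lborel)) =
    (\<Prod>e\<in>E. \<integral>\<^sup>+x. ennreal (exp (- (\<alpha> e * x))) * indicator (A e) x \<partial>lborel)"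
proof -
  have "(\<integral>\<^sup>+X. ennreal (exp (- (\<Sum>e\<in>E. \<alpha> e * X e))) * indicator (Pi\<^sub>E E A) X \<partial>Pi\<^sub>M E (\<lambda>_. lborel)) =
    (\<integral>\<^sup>+X. (\<Prod>e\<in>E. ennreal (exp (- (\<alpha> e * X e))) * indicator (A e) (X e)) \<partial>Pi\<^sub>M E (\<lambda>_. lborel))"
  proof (intro nn_integral_cong)
    fix X assume "X \<in> space (Pi\<^sub>M E (\<lambda>_. lborel :: real measure))"
    then have "X \<in> extensional E" by (simp add: space_PiM PiE_iff)
    moreover have "ennreal (exp (- (\<Sum>e\<in>E. \<alpha> e * X e))) = (\<Prod>e\<in>E. ennreal (exp (- (\<alpha> e * X e))))"
      using E by (simp add: prod_ennreal exp_sum sum_negf[symmetric])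
    ultimately show "ennreal (exp (- (\<Sum>e\<in>E. \<alpha> e * X e))) * indicator (Pi\<^sub>E E A) X =
      (\<Prod>e\<in>E. ennreal (exp (- (\<alpha> e * X e))) * indicator (A e) (X e))"
      by (simp add: indicator_PiE_eq_prod[OF E] prod.distrib)
  qed
  also have "\<dots> = (\<Prod>e\<in>E. \<integral>\<^sup>+x. ennreal (exp (- (\<alpha> e * x))) * indicator (A e) x \<partial>lborel)"
    using A by (intro lborel_product.product_nn_integral_prod[OF E]) auto
  finally show ?thesis .
qed

lemma nn_integral_exp_weight_orthant:
  assumes E: "finite E" and \<alpha>: "\<And>e. e \<in> E \<Longrightarrow> 0 < \<alpha> e"
  shows "(\<integral>\<^sup>+X. ennreal (exp (- (\<Sum>e\<in>E. \<alpha> e * X e))) * indicator (E \<rightarrow>\<^sub>E {0..}) X \<partial>Pi\<^sub>M E (\<lambda>_. lborel)) =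
    ennreal (\<Prod>e\<in>E. 1 / \<alpha> e)"
proof -
  have "(\<Prod>e\<in>E. \<integral>\<^sup>+x. ennreal (exp (- (\<alpha> e * x))) * indicator {0..} x \<partial>lborel) = (\<Prod>e\<in>E. ennreal (1 / \<alpha> e))"
    using nn_integral_exp_Ici[of _ 0] \<alpha> by (intro prod.cong) auto
  also have "\<dots> = ennreal (\<Prod>e\<in>E. 1 / \<alpha> e)" using \<alpha> by (intro prod_ennreal) (auto intro: less_imp_le)
  finally show ?thesis by (subst nn_integral_exp_weight_box[OF E]) auto
qed

text \<open>The box collects the weights whose threshold graph at \<open>p\<close> is
  \<open>G \<inter> E\<close>. After division by the total mass
  \<open>\<Prod>e\<in>E. 1 / \<alpha> e\<close> the weights are independent exponentials, so
  \<open>graph_weight\<close> is the law of a random edge set with independent edges.\<close>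

lemma nn_integral_exp_weight_graph:
  assumes E: "finite E" and \<alpha>: "\<And>e. e \<in> E \<Longrightarrow> 0 < \<alpha> e" and p: "0 \<le> p"
  shows "(\<integral>\<^sup>+X. ennreal (exp (- (\<Sum>e\<in>E. \<alpha> e * X e))) *
      indicator (\<Pi>\<^sub>E e\<in>E. if e \<in> G then {0..p} else {p<..}) X \<partial>Pi\<^sub>M E (\<lambda>_. lborel)) =
    ennreal (graph_weight (\<lambda>e. 1 - exp (- (\<alpha> e * p))) E G) * ennreal (\<Prod>e\<in>E. 1 / \<alpha> e)"
proof -
  have Ioi: "(\<integral>\<^sup>+x. ennreal (exp (- (a * x))) * indicator {p<..} x \<partial>lborel) = ennreal (exp (- (a * p)) / a)"
    if "0 < a" for a :: real
  proof -
    have "(\<integral>\<^sup>+x. ennreal (exp (- (a * x))) * indicator {p<..} x \<partial>lborel) =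
      (\<integral>\<^sup>+x. ennreal (exp (- (a * x))) * indicator {p..} x \<partial>lborel)"
      using AE_lborel_singleton[of p] by (intro nn_integral_cong_AE) (auto simp: indicator_def)
    then show ?thesis using nn_integral_exp_Ici[OF that p] by simp
  qed
  let ?q = "\<lambda>e. 1 - exp (- (\<alpha> e * p))"
  have q: "0 \<le> ?q e" if "e \<in> E" for e using \<alpha>[OF that] p by simp
  have "(\<Prod>e\<in>E. \<integral>\<^sup>+x. ennreal (exp (- (\<alpha> e * x))) * indicator (if e \<in> G then {0..p} else {p<..}) x \<partial>lborel) =
    (\<Prod>e\<in>E. ennreal ((if e \<in> G then ?q e else 1 - ?q e) * (1 / \<alpha> e)))"
    using nn_integral_exp_Icc[OF _ p] Ioi \<alpha> by (intro prod.cong refl) auto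
  also have "\<dots> = ennreal (\<Prod>e\<in>E. (if e \<in> G then ?q e else 1 - ?q e) * (1 / \<alpha> e))"
    using \<alpha> q by (intro prod_ennreal mult_nonneg_nonneg) (auto intro: less_imp_le)
  also have "\<dots> = ennreal (graph_weight ?q E G) * ennreal (\<Prod>e\<in>E. 1 / \<alpha> e)"
    unfolding graph_weight_def prod.distrib using q
    by (intro ennreal_mult prod_nonneg) (auto intro: less_imp_le[OF \<alpha>])
  finally show ?thesis by (subst nn_integral_exp_weight_box[OF E]) auto
qed

lemma borel_measurable_mst_weight [measurable]:
  "mst_weight n \<in> borel_measurable (Pi\<^sub>M (complete_edges n) (\<lambda>_. lborel))"
  unfolding mst_weight_def[abs_def]
  by (intro borel_measurable_Min finite_spanning_trees borel_measurable_sum)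
    (auto simp: spanning_trees_def intro!: measurable_component_singleton[where M = "\<lambda>_. lborel", simplified])

lemma mst_weight_scale:
  assumes "1 \<le> n" "0 < t"
  shows "mst_weight n (\<lambda>e\<in>complete_edges n. t * X e) = t * mst_weight n X"
proof -
  have ne: "spanning_trees n \<noteq> {}" using greedy_spanning_tree[OF assms(1)] by blast
  have "(\<Sum>e\<in>T. (\<lambda>e\<in>complete_edges n. t * X e) e) = t * (\<Sum>e\<in>T. X e)" if "T \<in> spanning_trees n" for T
    unfolding sum_distrib_left using that by (intro sum.cong) (auto simp: spanning_trees_def)
  then have "mst_weight n (\<lambda>e\<in>complete_edges n. t * X e) =
    Min ((*) t ` (\<lambda>T. \<Sum>e\<in>T. X e) ` spanning_trees n)"
    unfolding mst_weight_def image_image by (intro arg_cong[of _ _ Min] image_cong) auto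
  also have "\<dots> = t * mst_weight n X"
    unfolding mst_weight_def using assms ne finite_spanning_trees
    by (intro mono_Min_commute[symmetric]) (auto intro!: monoI mult_left_mono)
  finally show ?thesis .
qed

text \<open>The mean of kappa - 1 at threshold \<open>p\<close>. As a finite sum over graphs it is
  visibly measurable in \<open>p\<close>.\<close>

definition mean_excess :: "nat \<Rightarrow> (nat set \<Rightarrow> real) \<Rightarrow> real \<Rightarrow> real" where
  "mean_excess n \<alpha> p = (\<Sum>G\<in>Pow (complete_edges n).
     real (excess_components n G) * graph_weight (\<lambda>e. 1 - exp (- (\<alpha> e * p))) (complete_edges n) G)"

text \<open>The tree weight is replaced by its integral over \<open>p\<close>; once the two
  integrals are exchanged, the points with a given threshold graph form a box for each fixed
  \<open>p\<close>.\<close>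

lemma nn_integral_exp_weight_mst:
  assumes n: "1 \<le> n" and \<alpha>: "\<And>e. e \<in> complete_edges n \<Longrightarrow> 0 < \<alpha> e"
  shows "(\<integral>\<^sup>+X. ennreal (mst_weight n X) * ennreal (exp (- (\<Sum>e\<in>complete_edges n. \<alpha> e * X e))) *
      indicator (complete_edges n \<rightarrow>\<^sub>E {0..}) X \<partial>Pi\<^sub>M (complete_edges n) (\<lambda>_. lborel)) =
    (\<integral>\<^sup>+p. indicator {0..} p * ennreal (mean_excess n \<alpha> p) \<partial>lborel) *
    ennreal (\<Prod>e\<in>complete_edges n. 1 / \<alpha> e)"
proof -
  let ?E = "complete_edges n"
  let ?M = "Pi\<^sub>M ?E (\<lambda>_. lborel :: real measure)"
  let ?x = "\<lambda>X. ennreal (exp (- (\<Sum>e\<in>?E. \<alpha> e * X e)))"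
  let ?B = "\<lambda>G p. \<Pi>\<^sub>E e\<in>?E. if e \<in> G then {0..p} else {p<..}"
  let ?k = "\<lambda>G. ennreal (real (excess_components n G))"
  let ?c = "ennreal (\<Prod>e\<in>?E. 1 / \<alpha> e)"
  let ?w = "\<lambda>p. graph_weight (\<lambda>e. 1 - exp (- (\<alpha> e * p))) ?E"
  note E = finite_complete_edges[of n]
  interpret M: finite_product_sigma_finite "\<lambda>_. lborel :: real measure" ?E
    by standard (rule E)
  interpret P: pair_sigma_finite ?M "lborel :: real measure" by standard
  \<comment> \<open>In this form, built from indicators of inequalities, joint measurability in
    \<open>X\<close> and \<open>p\<close> is plain. The condition \<open>0 \<le> x\<close> absorbs
    the indicator of the orthant.\<close>
  let ?F = "\<lambda>X p. \<Sum>G\<in>Pow ?E. ?k G * (?x X * (indicator {0..} p *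
    (\<Prod>e\<in>?E. indicator {x. 0 \<le> x \<and> (if e \<in> G then x \<le> p else p < x)} (X e))))"
  \<comment> \<open>For \<open>p < 0\<close> the two products may differ, as \<open>{p<..}\<close>
    then contains negative numbers; the factor \<open>indicator {0..} p\<close> removes this
    case.\<close>
  have B: "indicator {0..} p * (\<Prod>e\<in>?E. indicator {x. 0 \<le> x \<and> (if e \<in> G then x \<le> p else p < x)} (X e)) =
    (indicator {0..} p * indicator (?B G p) X :: ennreal)" if "X \<in> space ?M" for X p G
  proof -
    have "X \<in> extensional ?E" using that by (simp add: space_PiM PiE_iff)
    show ?thesis
    proof (cases "0 \<le> p")
      case True
      then show ?thesis unfolding indicator_PiE_eq_prod[OF E \<open>X \<in> extensional ?E\<close>]
        by (intro arg_cong2[where f = "(*)"] prod.cong refl) (auto simp: indicator_def)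
    qed simp
  qed
  have "(\<integral>\<^sup>+X. ennreal (mst_weight n X) * ?x X * indicator (?E \<rightarrow>\<^sub>E {0..}) X \<partial>?M) =
    (\<integral>\<^sup>+X. (\<integral>\<^sup>+p. ?F X p \<partial>lborel) \<partial>?M)"
  proof (intro nn_integral_cong)
    fix X assume X: "X \<in> space ?M"
    show "ennreal (mst_weight n X) * ?x X * indicator (?E \<rightarrow>\<^sub>E {0..}) X = (\<integral>\<^sup>+p. ?F X p \<partial>lborel)"
    proof (cases "X \<in> ?E \<rightarrow>\<^sub>E {0..}")
      case False
      have "?F X p = 0" for p
      proof (intro sum.neutral ballI)
        fix G
        obtain e where "e \<in> ?E" "X e < 0" using False X by (force simp: space_PiM PiE_iff not_le)
        then have "(\<Prod>e\<in>?E. indicator {x. 0 \<le> x \<and> (if e \<in> G then x \<le> p else p < x)} (X e)) = (0 :: ennreal)"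
          using E by (intro prod_zero) (auto intro!: bexI[of _ e])
        then show "?k G * (?x X * (indicator {0..} p *
          (\<Prod>e\<in>?E. indicator {x. 0 \<le> x \<and> (if e \<in> G then x \<le> p else p < x)} (X e)))) = 0" by simp
      qed
      then show ?thesis using False by simp
    next
      case True
      have "?F X p = ?x X * (indicator {0..} p * ?k {e\<in>?E. X e \<le> p})" for p
      proof -
        \<comment> \<open>Only the threshold graph of \<open>X\<close> at \<open>p\<close> can
          contribute.\<close>
        have "?F X p = (\<Sum>G\<in>Pow ?E. if G = {e\<in>?E. X e \<le> p} then ?x X * (indicator {0..} p * ?k G) else 0)"
        proof (intro sum.cong refl)
          fix G assume G: "G \<in> Pow ?E"
          show "?k G * (?x X * (indicator {0..} p *
            (\<Prod>e\<in>?E. indicator {x. 0 \<le> x \<and> (if e \<in> G then x \<le> p else p < x)} (X e)))) =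
            (if G = {e\<in>?E. X e \<le> p} then ?x X * (indicator {0..} p * ?k G) else 0)"
          proof (cases "G = {e\<in>?E. X e \<le> p}")
            case G: True
            have "(\<Prod>e\<in>?E. indicator {x. 0 \<le> x \<and> (if e \<in> G then x \<le> p else p < x)} (X e)) = (1 :: ennreal)"
              using True G by (intro prod.neutral) (auto simp: PiE_iff)
            then show ?thesis using G by (simp only: ac_simps mult_1_right mult_1_left simp_thms if_True)
          next
            case ne: False
            then obtain e where "e \<in> ?E" "(e \<in> G) \<noteq> (X e \<le> p)" using G by blast
            then have "(\<Prod>e\<in>?E. indicator {x. 0 \<le> x \<and> (if e \<in> G then x \<le> p else p < x)} (X e)) = (0 :: ennreal)"
              using E by (intro prod_zero) (auto intro!: bexI[of _ e])
            then show ?thesis using ne by simp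
          qed
        qed
        then show ?thesis using E by (simp add: sum.delta)
      qed
      then have "(\<integral>\<^sup>+p. ?F X p \<partial>lborel) = (\<integral>\<^sup>+p. ?x X * (indicator {0..} p * ?k {e\<in>?E. X e \<le> p}) \<partial>lborel)"
        by (simp only:)
      also have "\<dots> = ?x X * (\<integral>\<^sup>+p. indicator {0..} p * ?k {e\<in>?E. X e \<le> p} \<partial>lborel)"
      proof (rule nn_integral_cmult)
        \<comment> \<open>Expanding over all possible graphs exhibits the component count as a
          combination of indicators in \<open>p\<close>, hence measurable.\<close>
        have eq: "?k {e\<in>?E. X e \<le> p} = (\<Sum>G\<in>Pow ?E. ?k G * (\<Prod>e\<in>?E. indicator {p. e \<in> G \<longleftrightarrow> X e \<le> p} p))" for p
        proof -
          have "(\<Sum>G\<in>Pow ?E. ?k G * (\<Prod>e\<in>?E. indicator {p. e \<in> G \<longleftrightarrow> X e \<le> p} p)) =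
            (\<Sum>G\<in>Pow ?E. if G = {e\<in>?E. X e \<le> p} then ?k G else 0)"
          proof (intro sum.cong refl)
            fix G assume G: "G \<in> Pow ?E"
            show "?k G * (\<Prod>e\<in>?E. indicator {p. e \<in> G \<longleftrightarrow> X e \<le> p} p) =
              (if G = {e\<in>?E. X e \<le> p} then ?k G else 0)"
            proof (cases "G = {e\<in>?E. X e \<le> p}")
              case ne: False
              then obtain e where "e \<in> ?E" "(e \<in> G) \<noteq> (X e \<le> p)" using G by blast
              then have "(\<Prod>e\<in>?E. indicator {p. e \<in> G \<longleftrightarrow> X e \<le> p} p) = (0 :: ennreal)"
                using E by (intro prod_zero) (auto intro!: bexI[of _ e])
              then show ?thesis using ne by simp
            qed simp
          qed
          then show ?thesis using E by (simp add: sum.delta)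
        qed
        show "(\<lambda>p. indicator {0..} p * ?k {e\<in>?E. X e \<le> p}) \<in> borel_measurable lborel"
          unfolding eq by measurable
      qed
      also have "(\<integral>\<^sup>+p. indicator {0..} p * ?k {e\<in>?E. X e \<le> p} \<partial>lborel) = ennreal (mst_weight n X)"
        using True by (intro mst_weight_attained(2)[symmetric] n) (auto simp: PiE_iff)
      finally show ?thesis using True by (simp add: mult.commute)
    qed
  qed
  also have "\<dots> = (\<integral>\<^sup>+p. (\<integral>\<^sup>+X. ?F X p \<partial>?M) \<partial>lborel)"
    by (rule P.Fubini'[symmetric]) (simp add: indicator_def split_beta' del: if_split cong: if_cong, measurable)
  also have "\<dots> = (\<integral>\<^sup>+p. indicator {0..} p * ennreal (mean_excess n \<alpha> p) * ?c \<partial>lborel)"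
  proof (intro nn_integral_cong)
    fix p :: real
    have "(\<integral>\<^sup>+X. ?F X p \<partial>?M) = (\<integral>\<^sup>+X. (\<Sum>G\<in>Pow ?E. ?k G * indicator {0..} p * (?x X * indicator (?B G p) X)) \<partial>?M)"
      by (intro nn_integral_cong sum.cong refl) (simp only: B ac_simps)
    also have "\<dots> = (\<Sum>G\<in>Pow ?E. ?k G * indicator {0..} p * (\<integral>\<^sup>+X. ?x X * indicator (?B G p) X \<partial>?M))"
    proof -
      have [measurable]: "?B G p \<in> sets ?M" for G
        using E by (intro sets_PiM_I_finite) auto
      show ?thesis by (subst nn_integral_sum) (auto intro!: sum.cong nn_integral_cmult)
    qed
    also have "\<dots> = (\<Sum>G\<in>Pow ?E. ?k G * indicator {0..} p * (ennreal (?w p G) * ?c))"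
    proof (cases "0 \<le> p")
      case True
      then show ?thesis using nn_integral_exp_weight_graph[OF E \<alpha>, where p = p] by simp
    qed simp
    also have "\<dots> = indicator {0..} p * (\<Sum>G\<in>Pow ?E. ?k G * ennreal (?w p G)) * ?c"
      by (simp add: sum_distrib_left sum_distrib_right ac_simps)
    also have "indicator {0..} p * (\<Sum>G\<in>Pow ?E. ?k G * ennreal (?w p G)) =
      indicator {0..} p * ennreal (mean_excess n \<alpha> p)"
    proof (cases "0 \<le> p")
      case True
      have "0 \<le> ?w p G" for G
        unfolding graph_weight_def using True \<alpha>
        by (intro prod_nonneg) (auto intro!: mult_nonneg_nonneg intro: less_imp_le)
      then show ?thesis using True
        by (simp add: mean_excess_def ennreal_mult[symmetric])
    qed simp
    finally show "(\<integral>\<^sup>+X. ?F X p \<partial>?M) = indicator {0..} p * ennreal (mean_excess n \<alpha> p) * ?c" .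
  qed
  also have "\<dots> = (\<integral>\<^sup>+p. indicator {0..} p * ennreal (mean_excess n \<alpha> p) \<partial>lborel) * ?c"
    by (rule nn_integral_multc) (simp add: mean_excess_def graph_weight_def, measurable)
  finally show ?thesis .
qed

section \<open>Back to the uniform distribution on the simplex\<close>

lemma sets_weight_simplex: "weight_simplex n \<alpha> \<in> sets (Pi\<^sub>M (complete_edges n) (\<lambda>_. lborel))"
proof -
  let ?M = "Pi\<^sub>M (complete_edges n) (\<lambda>_. lborel :: real measure)"
  have "complete_edges n \<rightarrow>\<^sub>E {0..} \<in> sets ?M"
    using finite_complete_edges by (intro sets_PiM_I_finite) auto
  moreover have "weight_simplex n \<alpha> = (complete_edges n \<rightarrow>\<^sub>E {0..}) \<inter>
    {X \<in> space ?M. (\<Sum>e\<in>complete_edges n. \<alpha> e * X e) \<le> real (n choose 2)}"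
    by (auto simp: weight_simplex_def space_PiM PiE_iff extensional_def)
  moreover have "{X \<in> space ?M. (\<Sum>e\<in>complete_edges n. \<alpha> e * X e) \<le> real (n choose 2)} \<in> sets ?M"
    by measurable
  ultimately show ?thesis by simp
qed

text \<open>With \<open>c\<close> the product of the \<open>1 / \<alpha> e\<close> and L the
  integral over \<open>p\<close>, the exponential identity gives V = c / N! for the volume of the
  unit simplex and I = c L / (N + 1)! for the tree weight on it. Scaling to level N contributes N^N
  and N^(N + 1), which leaves N / (N + 1) times L.\<close>

lemma nn_integral_uniform_simplex_mst:
  assumes n: "2 \<le> n" and \<alpha>: "\<And>e. e \<in> complete_edges n \<Longrightarrow> 0 < \<alpha> e"
  shows "(\<integral>\<^sup>+X. ennreal (mst_weight n X) \<partial>uniform_simplex n \<alpha>) =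
    ennreal (real (n choose 2) / (real (n choose 2) + 1)) *
    (\<integral>\<^sup>+p. indicator {0..} p * ennreal (mean_excess n \<alpha> p) \<partial>lborel)" (is "_ = _ * ?L")
proof -
  let ?E = "complete_edges n"
  let ?M = "Pi\<^sub>M ?E (\<lambda>_. lborel :: real measure)"
  let ?S = "\<lambda>t. {X \<in> ?E \<rightarrow>\<^sub>E {0..}. (\<Sum>e\<in>?E. \<alpha> e * X e) \<le> t}"
  let ?h = "\<lambda>X. ennreal (mst_weight n X)"
  define N where "N = n choose 2"
  define c where "c = (\<Prod>e\<in>?E. 1 / \<alpha> e)"
  define V where "V = (\<integral>\<^sup>+X. 1 * indicator (?S 1) X \<partial>?M)"
  define I where "I = (\<integral>\<^sup>+X. ?h X * indicator (?S 1) X \<partial>?M)"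
  note E = finite_complete_edges[of n]
  have N: "0 < real N" using n by (simp add: N_def)
  have cardE: "card ?E = N" by (simp add: complete_edges_card N_def)
  have c: "0 < c" unfolding c_def using \<alpha> by (intro prod_pos) simp
  have h[measurable]: "?h \<in> borel_measurable ?M" by measurable
  have hom: "?h (\<lambda>e\<in>?E. t * X e) = ennreal (t ^ 1) * ?h X" if "0 < t" for X t
    using n that by (simp add: mst_weight_scale ennreal_mult')
  have S: "weight_simplex n \<alpha> = ?S (real N)" by (simp add: weight_simplex_def N_def)
  have "fact (N + 0) * V = ennreal c"
    using nn_integral_exp_weight_eq_simplex[OF E \<alpha>, where h = "\<lambda>_. 1" and m = 0] nn_integral_exp_weight_orthant[OF E \<alpha>]
    by (simp add: V_def c_def cardE)
  then have "ennreal (1 / fact N) * (ennreal (fact N) * V) = ennreal (1 / fact N) * ennreal c"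
    by (simp add: ennreal_fact)
  then have V: "V = ennreal (c / fact N)"
    by (simp add: mult.assoc[symmetric] ennreal_mult'[symmetric])
  have "fact (N + 1) * I = ?L * ennreal c"
    using nn_integral_exp_weight_eq_simplex[OF E \<alpha> h hom] nn_integral_exp_weight_mst[OF _ \<alpha>] n
    by (simp add: I_def c_def cardE)
  then have "ennreal (1 / fact (N + 1)) * (ennreal (fact (N + 1)) * I) =
    ennreal (1 / fact (N + 1)) * (?L * ennreal c)"
    by (simp only: ennreal_fact)
  then have I: "I = ennreal (c / fact (N + 1)) * ?L"
    using c by (simp add: mult.assoc[symmetric] ennreal_mult'[symmetric] mult.commute[of ?L] del: fact_Suc)
  have "emeasure ?M (weight_simplex n \<alpha>) = (\<integral>\<^sup>+X. 1 * indicator (?S (real N)) X \<partial>?M)"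
    using sets_weight_simplex[of n \<alpha>] by (simp add: S)
  also have "\<dots> = ennreal (real N ^ (N + 0)) * V"
    unfolding V_def cardE[symmetric]
    by (rule nn_integral_simplex_scale) (use N E in \<open>auto simp: cardE\<close>)
  finally have vol: "emeasure ?M (weight_simplex n \<alpha>) = ennreal (real N ^ N * (c / fact N))"
    using c by (simp add: V ennreal_mult[symmetric])
  have "(\<integral>\<^sup>+X. ?h X * indicator (weight_simplex n \<alpha>) X \<partial>?M) = ennreal (real N ^ (N + 1)) * I"
    unfolding I_def S cardE[symmetric]
    by (rule nn_integral_simplex_scale) (use N E h hom in \<open>auto simp: cardE\<close>)
  also have "\<dots> = ennreal (real N ^ (N + 1) * (c / fact (N + 1))) * ?L"
    using c by (simp only: I mult.assoc[symmetric] ennreal_mult'[symmetric] zero_le_power of_nat_0_le_iff)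
  finally have int: "(\<integral>\<^sup>+X. ?h X * indicator (weight_simplex n \<alpha>) X \<partial>?M) =
    ennreal (real N ^ (N + 1) * (c / fact (N + 1))) * ?L" .
  have "(\<integral>\<^sup>+X. ?h X \<partial>uniform_simplex n \<alpha>) =
    ennreal (real N ^ (N + 1) * (c / fact (N + 1))) * ?L / ennreal (real N ^ N * (c / fact N))"
    unfolding uniform_simplex_def nn_integral_uniform_measure[OF h sets_weight_simplex] int vol ..
  also have "\<dots> = ennreal (real N ^ (N + 1) * (c / fact (N + 1))) / ennreal (real N ^ N * (c / fact N)) * ?L"
    by (rule ennreal_times_divide[symmetric, of "?L", simplified mult.commute])
  also have "ennreal (real N ^ (N + 1) * (c / fact (N + 1))) / ennreal (real N ^ N * (c / fact N)) =
    ennreal ((real N ^ (N + 1) * (c / fact (N + 1))) / (real N ^ N * (c / fact N)))"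
    using c N by (intro divide_ennreal) (auto intro!: mult_nonneg_nonneg)
  also have "(real N ^ (N + 1) * (c / fact (N + 1))) / (real N ^ N * (c / fact N)) = real N / (real N + 1)"
  proof -
    have "(P * real N * (c / ((real N + 1) * F))) / (P * (c / F)) = real N / (real N + 1)"
      if "0 < P" "0 < F" for P F :: real
      using c N that by (simp add: divide_simps)
    from this[of "real N ^ N" "fact N"] show ?thesis using N by (simp add: ac_simps)
  qed
  finally show ?thesis by (simp add: N_def)
qed

text \<open>\<open>enn2real\<close> sends an infinite value to 0, in accordance with the Bochner
  integral; finiteness is a consequence of the later bound \<open>mst_integral_le\<close>.\<close>

lemma integral_uniform_simplex_mst:
  assumes n: "2 \<le> n" and \<alpha>: "\<And>e. e \<in> complete_edges n \<Longrightarrow> 0 < \<alpha> e"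
  shows "(\<integral>X. mst_weight n X \<partial>uniform_simplex n \<alpha>) =
    real (n choose 2) / (real (n choose 2) + 1) *
    enn2real (\<integral>\<^sup>+p. indicator {0..} p * ennreal (mean_excess n \<alpha> p) \<partial>lborel)"
proof -
  have "AE X in uniform_simplex n \<alpha>. 0 \<le> mst_weight n X"
    unfolding uniform_simplex_def
  proof (rule AE_uniform_measureI[OF sets_weight_simplex], intro AE_I2 impI)
    fix X assume "X \<in> weight_simplex n \<alpha>"
    then show "0 \<le> mst_weight n X"
      using n by (intro mst_weight_attained(1)) (auto simp: weight_simplex_def PiE_iff)
  qed
  moreover have "mst_weight n \<in> borel_measurable (uniform_simplex n \<alpha>)"
    using borel_measurable_mst_weight[of n] by (simp add: uniform_simplex_def uniform_measure_def)
  ultimately have "(\<integral>X. mst_weight n X \<partial>uniform_simplex n \<alpha>) =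
    enn2real (\<integral>\<^sup>+X. ennreal (mst_weight n X) \<partial>uniform_simplex n \<alpha>)"
    by (intro integral_eq_nn_integral) auto
  also have "\<dots> = real (n choose 2) / (real (n choose 2) + 1) *
    enn2real (\<integral>\<^sup>+p. indicator {0..} p * ennreal (mean_excess n \<alpha> p) \<partial>lborel)"
    by (simp add: nn_integral_uniform_simplex_mst[OF assms] enn2real_mult)
  finally show ?thesis .
qed

section \<open>Random graphs\<close>

definition graph_mean :: "('e \<Rightarrow> real) \<Rightarrow> 'e set \<Rightarrow> ('e set \<Rightarrow> real) \<Rightarrow> real" where
  "graph_mean q E f = (\<Sum>G\<in>Pow E. f G * graph_weight q E G)"

lemma graph_weight_Un:
  assumes "finite A" "finite B" "A \<inter> B = {}" "G \<subseteq> A" "H \<subseteq> B"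
  shows "graph_weight q (A \<union> B) (G \<union> H) = graph_weight q A G * graph_weight q B H"
  unfolding graph_weight_def prod.union_disjoint[OF assms(1-3)] using assms(3-5)
  by (intro arg_cong2[where f = "(*)"] prod.cong) auto

text \<open>Independence: the edges of \<open>A\<close> may be revealed before those of
  \<open>B\<close>.\<close>

lemma graph_mean_Un:
  assumes "finite A" "finite B" "A \<inter> B = {}"
  shows "graph_mean q (A \<union> B) f = graph_mean q A (\<lambda>G. graph_mean q B (\<lambda>H. f (G \<union> H)))"
proof -
  have "graph_mean q (A \<union> B) f = (\<Sum>(G, H)\<in>Pow A \<times> Pow B. f (G \<union> H) * graph_weight q (A \<union> B) (G \<union> H))"
    unfolding graph_mean_def using assms(3)
    by (intro sum.reindex_bij_witness[of _ "\<lambda>(G, H). G \<union> H" "\<lambda>G. (G \<inter> A, G \<inter> B)"])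
      (auto simp: Int_Un_distrib2 Int_Un_distrib[symmetric] Int_absorb2)
  also have "\<dots> = (\<Sum>(G, H)\<in>Pow A \<times> Pow B. f (G \<union> H) * graph_weight q B H * graph_weight q A G)"
    using graph_weight_Un[OF assms] by (intro sum.cong) (auto simp: ac_simps)
  also have "\<dots> = graph_mean q A (\<lambda>G. graph_mean q B (\<lambda>H. f (G \<union> H)))"
    unfolding graph_mean_def sum_distrib_right by (simp add: sum.cartesian_product)
  finally show ?thesis .
qed

text \<open>Allows the star of edges at a root to be indexed by its leaves.\<close>

lemma graph_mean_image:
  assumes "inj_on g U"
  shows "graph_mean q (g ` U) f = graph_mean (\<lambda>u. q (g u)) U (\<lambda>A. f (g ` A))"
proof -
  have w: "graph_weight q (g ` U) (g ` A) = graph_weight (\<lambda>u. q (g u)) U A" if "A \<subseteq> U" for A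
    unfolding graph_weight_def prod.reindex[OF assms] o_def using assms that
    by (intro prod.cong) (auto simp: inj_on_image_mem_iff)
  show ?thesis
    unfolding graph_mean_def image_Pow_surj[OF refl, symmetric]
    using w by (subst sum.reindex[OF inj_on_image_Pow[OF assms]]) (auto intro!: sum.cong)
qed

lemma graph_weight_nonneg:
  assumes "\<And>e. e \<in> E \<Longrightarrow> 0 \<le> q e \<and> q e \<le> 1"
  shows "0 \<le> graph_weight q E G"
  unfolding graph_weight_def using assms by (intro prod_nonneg) auto

lemma graph_mean_const:
  assumes "finite E"
  shows "graph_mean q E (\<lambda>_. c) = c"
proof -
  have "(\<Sum>G\<in>Pow E. graph_weight q E G) = (\<Prod>e\<in>E. q e + (1 - q e))"
    unfolding prod_add[OF assms]
  proof (intro sum.cong refl)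
    fix G assume "G \<in> Pow E"
    then have "E = G \<union> (E - G)" "finite G" using assms finite_subset by auto
    then have "graph_weight q E G = (\<Prod>e\<in>G \<union> (E - G). if e \<in> G then q e else 1 - q e)"
      by (simp add: graph_weight_def)
    also have "\<dots> = prod q G * (\<Prod>e\<in>E - G. 1 - q e)"
      using assms \<open>finite G\<close> by (subst prod.union_disjoint) auto
    finally show "graph_weight q E G = prod q G * (\<Prod>e\<in>E - G. 1 - q e)" .
  qed
  then show ?thesis by (simp add: graph_mean_def sum_distrib_left[symmetric])
qed

lemma graph_mean_mono:
  assumes "\<And>e. e \<in> E \<Longrightarrow> 0 \<le> q e \<and> q e \<le> 1" "\<And>G. G \<subseteq> E \<Longrightarrow> f G \<le> g G"
  shows "graph_mean q E f \<le> graph_mean q E g"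
  unfolding graph_mean_def using assms
  by (intro sum_mono mult_right_mono graph_weight_nonneg) auto

lemma graph_mean_cong:
  "(\<And>G. G \<subseteq> E \<Longrightarrow> f G = g G) \<Longrightarrow> graph_mean q E f = graph_mean q E g"
  unfolding graph_mean_def by (intro sum.cong) auto

lemma graph_mean_add: "graph_mean q E (\<lambda>G. f G + g G) = graph_mean q E f + graph_mean q E g"
  by (simp add: graph_mean_def sum.distrib algebra_simps)

lemma graph_mean_sum: "graph_mean q E (\<lambda>G. \<Sum>i\<in>I. f i G) = (\<Sum>i\<in>I. graph_mean q E (f i))"
  unfolding graph_mean_def sum_distrib_right by (rule sum.swap)

section \<open>Exploration of a graph from a set of roots\<close>

definition reaches :: "'a set \<Rightarrow> 'a set \<Rightarrow> 'a set set \<Rightarrow> bool" where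
  "reaches R U G \<longleftrightarrow> (\<forall>u\<in>U. \<exists>r\<in>R. (r, u) \<in> {(x, y). {x, y} \<in> G \<and> y \<in> U}\<^sup>*)"

text \<open>In \<open>reaches\<close> every step must enter \<open>U\<close>, so a walk never
  returns to a root. Hence \<open>r\<close> can be deleted once its neighbours \<open>A\<close> in
  \<open>U\<close> are known: they take its place as roots.\<close>

lemma reaches_explore:
  assumes disj: "R \<inter> U = {}" and r: "r \<in> R" and A: "A \<subseteq> U" and H: "\<And>u. u \<in> U \<Longrightarrow> {r, u} \<notin> H"
  shows "reaches R U ((\<lambda>u. {r, u}) ` A \<union> H) \<longleftrightarrow> reaches (R - {r} \<union> A) (U - A) H"
proof -
  define G where "G = (\<lambda>u. {r, u}) ` A \<union> H"
  define g where "g = {(x, y). {x, y} \<in> G \<and> y \<in> U}"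
  define h where "h = {(x, y). {x, y} \<in> H \<and> y \<in> U - A}"
  have hg: "h\<^sup>* \<subseteq> g\<^sup>*" by (intro rtrancl_mono) (auto simp: g_def h_def G_def)
  have rA: "(r, a) \<in> g" if "a \<in> A" for a using that A by (auto simp: g_def G_def)
  have "reaches R U G" if L: "reaches (R - {r} \<union> A) (U - A) H"
    unfolding reaches_def g_def[symmetric]
  proof
    fix u assume u: "u \<in> U"
    show "\<exists>r\<in>R. (r, u) \<in> g\<^sup>*"
    proof (cases "u \<in> A")
      case True
      then show ?thesis using rA r by blast
    next
      case False
      then obtain s where s: "s \<in> R - {r} \<union> A" "(s, u) \<in> h\<^sup>*"
        using L u unfolding reaches_def h_def[symmetric] by blast
      then have su: "(s, u) \<in> g\<^sup>*" using hg by blast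
      show ?thesis
      proof (cases "s \<in> A")
        case True
        then have "(r, u) \<in> g\<^sup>*" using converse_rtrancl_into_rtrancl[OF rA su] by blast
        then show ?thesis using r by blast
      next
        case False
        then show ?thesis using s su by blast
      qed
    qed
  qed
  moreover have "reaches (R - {r} \<union> A) (U - A) H" if L: "reaches R U G"
    unfolding reaches_def h_def[symmetric]
  proof
    fix u assume u: "u \<in> U - A"
    obtain s where s: "s \<in> R" "(s, u) \<in> g\<^sup>*"
      using L u unfolding reaches_def g_def[symmetric] by blast
    \<comment> \<open>The invariant along the walk: it stands at \<open>r\<close>, or its current
      vertex is reached from the new roots inside \<open>U - A\<close>. Entering \<open>A\<close>
      restarts the walk at a new root.\<close>
    have "u = r \<or> (\<exists>t\<in>R - {r} \<union> A. (t, u) \<in> h\<^sup>*)"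
      using s(2)
    proof (induction rule: rtrancl_induct)
      case base
      then show ?case using s(1) by blast
    next
      case (step y z)
      have yz: "{y, z} \<in> G" "z \<in> U" using step.hyps by (auto simp: g_def)
      show ?case
      proof (cases "z \<in> A")
        case True
        then show ?thesis by blast
      next
        case False
        have "z \<noteq> r" using disj r yz by blast
        have nA: "{y, z} \<notin> (\<lambda>u. {r, u}) ` A"
          using False \<open>z \<noteq> r\<close> by (auto simp: doubleton_eq_iff)
        then have H': "{y, z} \<in> H" using yz by (simp add: G_def)
        then have "y \<noteq> r" using H yz by blast
        then obtain t where t: "t \<in> R - {r} \<union> A" "(t, y) \<in> h\<^sup>*" using step.IH by blast
        have "(y, z) \<in> h" using H' yz False by (simp add: h_def)
        then show ?thesis using t rtrancl_into_rtrancl by metis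
      qed
    qed
    moreover have "u \<noteq> r" using disj r u by blast
    ultimately show "\<exists>t\<in>R - {r} \<union> A. (t, u) \<in> h\<^sup>*" by blast
  qed
  ultimately show ?thesis unfolding G_def by blast
qed

section \<open>Subset sums behind the weighted Cayley formula\<close>

lemma sum_Pow_power:
  fixes x y :: real
  assumes "finite U"
  shows "(\<Sum>A\<in>Pow U. x ^ card A * y ^ (card U - card A)) = (x + y) ^ card U"
proof -
  have "(x + y) ^ card U = (\<Prod>u\<in>U. x + y)" by simp
  also have "\<dots> = (\<Sum>A\<in>Pow U. x ^ card A * y ^ (card U - card A))"
    unfolding prod_add[OF assms] using assms
    by (intro sum.cong refl) (auto simp: card_Diff_subset finite_subset)
  finally show ?thesis by simp
qed

text \<open>The sets \<open>A\<close> containing a given \<open>u\<close> have total weight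
  \<open>x * (x + y) ^ (card U - 1)\<close>; the factor \<open>x + y\<close> on the left avoids the
  exponent \<open>card U - 1\<close>.\<close>

lemma sum_Pow_weighted_power:
  fixes d :: "'a \<Rightarrow> real"
  assumes "finite U"
  shows "(x + y) * (\<Sum>A\<in>Pow U. sum d A * x ^ card A * y ^ (card U - card A)) =
    sum d U * x * (x + y) ^ card U"
  using assms
proof (induction U rule: finite_induct)
  case (insert v U)
  let ?T = "\<Sum>A\<in>Pow U. sum d A * x ^ card A * y ^ (card U - card A)"
  have fin: "finite A" "card A \<le> card U" "v \<notin> A" if "A \<in> Pow U" for A
    using that insert.hyps finite_subset[of A U] card_mono[of U A] by auto
  have "Pow U \<inter> insert v ` Pow U = {}" using insert.hyps by blast
  moreover have inj: "inj_on (insert v) (Pow U)"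
    by (rule inj_onI) (metis fin(3) insert_ident)
  ultimately have "(\<Sum>A\<in>Pow (insert v U). sum d A * x ^ card A * y ^ (card (insert v U) - card A)) =
    (\<Sum>A\<in>Pow U. sum d A * x ^ card A * y ^ (Suc (card U) - card A)) +
    (\<Sum>A\<in>Pow U. sum d (insert v A) * x ^ card (insert v A) * y ^ (Suc (card U) - card (insert v A)))"
    unfolding Pow_insert using insert.hyps
    by (subst sum.union_disjoint) (auto simp: sum.reindex)
  also have "(\<Sum>A\<in>Pow U. sum d A * x ^ card A * y ^ (Suc (card U) - card A)) = y * ?T"
    unfolding sum_distrib_left using fin by (intro sum.cong refl) (simp add: Suc_diff_le)
  also have "(\<Sum>A\<in>Pow U. sum d (insert v A) * x ^ card (insert v A) * y ^ (Suc (card U) - card (insert v A))) =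
    (\<Sum>A\<in>Pow U. x * (sum d A * x ^ card A * y ^ (card U - card A)) +
       x * d v * (x ^ card A * y ^ (card U - card A)))"
    using fin by (intro sum.cong refl) (simp add: algebra_simps)
  also have "\<dots> = x * ?T + x * d v * (x + y) ^ card U"
    by (simp only: sum.distrib sum_distrib_left[symmetric] sum_Pow_power[OF insert.hyps(1)])
  finally have "(x + y) * (\<Sum>A\<in>Pow (insert v U). sum d A * x ^ card A * y ^ (card (insert v U) - card A)) =
    (x + y) * ((x + y) * ?T) + d v * x * (x + y) ^ Suc (card U)"
    by (simp add: algebra_simps)
  then show ?case unfolding insert.IH using insert.hyps by (simp add: algebra_simps)
qed simp

text \<open>One exploration step with the common factors removed: \<open>x\<close> is the weight of
  the explored root, \<open>s\<close> that of the other roots. The term \<open>A = U\<close> stands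
  apart because the exponent \<open>card U - card A - 1\<close>, ideally -1 there, is truncated to
  0, whereas an empty set of unreached vertices must contribute 1.\<close>

lemma forest_identity:
  fixes d :: "'a \<Rightarrow> real"
  assumes U: "finite U" "U \<noteq> {}" and pos: "\<And>u. u \<in> U \<Longrightarrow> 0 < d u" and s: "0 \<le> s" and x: "0 < x"
  shows "(\<Sum>A\<in>Pow U. if A = U then x ^ card U
      else x ^ card A * ((s + sum d A) * (s + sum d U) ^ (card U - card A - 1))) =
    (s + x) * (s + x + sum d U) ^ (card U - 1)" (is "?S = _")
proof -
  define y where "y = s + sum d U"
  have y: "0 < y" using U pos s by (simp add: y_def add_nonneg_pos sum_pos)
  obtain k where k: "card U = Suc k" using U by (metis card_eq_0_iff not0_implies_Suc)
  \<comment> \<open>Multiplying by \<open>y\<close> restores the missing power, and the term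
    \<open>A = U\<close> then has the same shape as the others.\<close>
  have "y * ?S = (\<Sum>A\<in>Pow U. s * (x ^ card A * y ^ (card U - card A)) + sum d A * x ^ card A * y ^ (card U - card A))"
    unfolding sum_distrib_left
  proof (intro sum.cong refl)
    fix A assume A: "A \<in> Pow U"
    show "y * (if A = U then x ^ card U else x ^ card A * ((s + sum d A) * (s + sum d U) ^ (card U - card A - 1))) =
      s * (x ^ card A * y ^ (card U - card A)) + sum d A * x ^ card A * y ^ (card U - card A)"
    proof (cases "A = U")
      case False
      then have "card A < card U" using A U psubset_card_mono by blast
      then obtain j where "card U - card A = Suc j" by (metis Suc_diff_Suc)
      then have "y ^ (card U - card A) = y * y ^ (card U - card A - 1)" by simp
      then show ?thesis using False by (simp add: y_def[symmetric] algebra_simps)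
    qed (simp add: y_def algebra_simps)
  qed
  also have "\<dots> = s * (x + y) ^ card U + (\<Sum>A\<in>Pow U. sum d A * x ^ card A * y ^ (card U - card A))"
    by (simp only: sum.distrib sum_distrib_left[symmetric] sum_Pow_power[OF U(1)])
  finally have "(x + y) * (y * ?S) = (x + y) * (s * (x + y) ^ card U) + sum d U * x * (x + y) ^ card U"
    using sum_Pow_weighted_power[OF U(1), of x y d] by (simp add: distrib_left)
  also have "\<dots> = (x + y) * (y * ((s + x) * (x + y) ^ k))"
    by (simp add: k y_def algebra_simps)
  finally have "?S = (s + x) * (x + y) ^ k" using x y by simp
  then show ?thesis by (simp add: k y_def ac_simps)
qed

text \<open>The total weight of the forests on \<open>R \<union> U\<close> rooted at \<open>R\<close>, where the edge \<open>xy\<close> has weight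
  \<open>p d\<^sub>x d\<^sub>y\<close> (a weighted form of Cayley's formula).\<close>

definition forest_poly :: "real \<Rightarrow> ('a \<Rightarrow> real) \<Rightarrow> 'a set \<Rightarrow> 'a set \<Rightarrow> real" where
  "forest_poly p d R U = (if U = {} then 1
     else p ^ card U * prod d U * (sum d R * (sum d R + sum d U) ^ (card U - 1)))"

lemma forest_poly_nonneg:
  assumes "\<And>v. v \<in> R \<union> U \<Longrightarrow> 0 < d v" "0 \<le> p"
  shows "0 \<le> forest_poly p d R U"
  using assms unfolding forest_poly_def
  by (auto intro!: mult_nonneg_nonneg prod_nonneg sum_nonneg add_nonneg_nonneg zero_le_power intro: less_imp_le)

text \<open>The forests are sorted by the set \<open>A\<close> of children of \<open>r\<close>;
  deleting \<open>r\<close> leaves a forest rooted at \<open>A\<close> and the other roots.\<close>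

lemma forest_poly_explore:
  fixes d :: "'a \<Rightarrow> real"
  assumes fin: "finite R" "finite U" and disj: "R \<inter> U = {}" and r: "r \<in> R" and U: "U \<noteq> {}"
    and pos: "\<And>v. v \<in> R \<union> U \<Longrightarrow> 0 < d v"
  shows "(\<Sum>A\<in>Pow U. (\<Prod>a\<in>A. d r * d a * p) * forest_poly p d (R - {r} \<union> A) (U - A)) = forest_poly p d R U"
proof -
  define s where "s = sum d (R - {r})"
  have R: "sum d R = s + d r" using fin r by (simp add: s_def sum.remove[of R r])
  have "(\<Prod>a\<in>A. d r * d a * p) * forest_poly p d (R - {r} \<union> A) (U - A) =
      p ^ card U * prod d U * (if A = U then d r ^ card U
        else d r ^ card A * ((s + sum d A) * (s + sum d U) ^ (card U - card A - 1)))"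
    if A: "A \<in> Pow U" for A
  proof -
    have finA: "finite A" using A fin finite_subset by blast
    have pr: "(\<Prod>a\<in>A. d r * d a * p) = d r ^ card A * prod d A * p ^ card A"
      by (simp add: prod.distrib)
    show ?thesis
    proof (cases "A = U")
      case True
      then show ?thesis using pr by (simp add: forest_poly_def)
    next
      case False
      have sA: "sum d (R - {r} \<union> A) = s + sum d A"
        unfolding s_def using fin finA disj A by (intro sum.union_disjoint) auto
      have sU: "sum d A + sum d (U - A) = sum d U"
        using A fin by (metis Pow_iff sum.subset_diff add.commute)
      have pU: "prod d A * prod d (U - A) = prod d U"
        using A fin by (metis Pow_iff prod.subset_diff mult.commute)
      have cU: "card (U - A) = card U - card A" "card A \<le> card U"
        using A fin finA by (auto simp: card_Diff_subset card_mono)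
      have "p ^ card A * p ^ (card U - card A) = p ^ card U"
        using cU by (simp add: power_add[symmetric])
      moreover have "U - A \<noteq> {}" using A False by blast
      moreover have "s + sum d A + sum d (U - A) = s + sum d U" using sU by simp
      ultimately show ?thesis using False
        by (simp add: forest_poly_def pr sA cU(1) pU[symmetric])
          (simp add: ac_simps flip: \<open>p ^ card A * p ^ (card U - card A) = p ^ card U\<close>)
    qed
  qed
  then have "(\<Sum>A\<in>Pow U. (\<Prod>a\<in>A. d r * d a * p) * forest_poly p d (R - {r} \<union> A) (U - A)) =
    p ^ card U * prod d U * (\<Sum>A\<in>Pow U. if A = U then d r ^ card U
      else d r ^ card A * ((s + sum d A) * (s + sum d U) ^ (card U - card A - 1)))"
    by (simp add: sum_distrib_left)
  also have "\<dots> = p ^ card U * prod d U * ((s + d r) * (s + d r + sum d U) ^ (card U - 1))"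
    using pos r U fin
    by (subst forest_identity) (auto simp: s_def intro!: sum_nonneg intro: less_imp_le)
  finally show ?thesis using U by (simp add: forest_poly_def R)
qed

section \<open>Probability bounds for the exploration\<close>

lemma one_minus_exp_bounds:
  fixes z :: real
  assumes "0 \<le> z"
  shows "1 - exp (- z) \<le> z" "z * exp (- z) \<le> 1 - exp (- z)"
proof -
  show "1 - exp (- z) \<le> z" using exp_ge_add_one_self[of "- z"] by simp
  have "(1 + z) * exp (- z) \<le> exp z * exp (- z)" by (intro mult_right_mono exp_ge_add_one_self) auto
  then show "z * exp (- z) \<le> 1 - exp (- z)" by (simp add: exp_add[symmetric] algebra_simps)
qed

text \<open>Let z = x d_u p for a leaf u. A present edge has probability between z exp (- z) and z,
  an absent one has probability exp (- z), at most 1. The lower bound thus collects one factor exp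
  (- z) per leaf, present or not.\<close>

lemma star_weight_bounds:
  fixes d :: "'a \<Rightarrow> real"
  assumes U: "finite U" "A \<subseteq> U" and pos: "0 < x" "\<And>u. u \<in> U \<Longrightarrow> 0 < d u" "0 \<le> p"
    and q: "\<And>u. u \<in> U \<Longrightarrow> q u = 1 - exp (- (x * d u * p))"
  shows "graph_weight q U A \<le> (\<Prod>a\<in>A. x * d a * p)"
    and "(\<Prod>a\<in>A. x * d a * p) * exp (- (p * (x * sum d U))) \<le> graph_weight q U A"
proof -
  have z: "0 \<le> x * d u * p" if "u \<in> U" for u using pos that by (simp add: less_imp_le)
  have eq: "graph_weight q U A = prod q A * (\<Prod>u\<in>U - A. 1 - q u)"
    unfolding graph_weight_def prod.subset_diff[OF U(2,1)]
    using U(2) by (subst mult.commute, intro arg_cong2[where f = "(*)"] prod.cong) auto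
  have qb: "0 \<le> q u" "q u \<le> 1" "q u \<le> x * d u * p" "x * d u * p * exp (- (x * d u * p)) \<le> q u" if "u \<in> U" for u
    using z[OF that] one_minus_exp_bounds[OF z[OF that]] by (auto simp: q[OF that])
  have "prod q A * (\<Prod>u\<in>U - A. 1 - q u) \<le> (\<Prod>a\<in>A. x * d a * p) * 1"
    using qb U(2) z by (intro mult_mono prod_mono prod_le_1 prod_nonneg) (auto simp: subset_iff)
  then show "graph_weight q U A \<le> (\<Prod>a\<in>A. x * d a * p)" by (simp add: eq)
  have "exp (- (p * (x * sum d U))) = (\<Prod>u\<in>U. exp (- (x * d u * p)))"
    using U by (simp add: exp_sum[symmetric] sum_negf sum_distrib_left ac_simps)
  also have "\<dots> = (\<Prod>u\<in>A. exp (- (x * d u * p))) * (\<Prod>u\<in>U - A. 1 - q u)"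
    unfolding prod.subset_diff[OF U(2,1)] using q by (simp add: mult.commute)
  finally have "(\<Prod>a\<in>A. x * d a * p) * exp (- (p * (x * sum d U))) =
    (\<Prod>a\<in>A. x * d a * p * exp (- (x * d a * p))) * (\<Prod>u\<in>U - A. 1 - q u)"
    by (simp add: prod.distrib)
  also have "\<dots> \<le> prod q A * (\<Prod>u\<in>U - A. 1 - q u)"
    using qb U(2) z by (intro mult_right_mono prod_mono prod_nonneg) (auto simp: subset_iff)
  finally show "(\<Prod>a\<in>A. x * d a * p) * exp (- (p * (x * sum d U))) \<le> graph_weight q U A"
    by (simp add: eq)
qed

text \<open>Exploring the neighbours of one root \<open>r\<close> at a time gives the same recursion as
  \<open>forest_poly\<close>, up to an exponential factor.\<close>

lemma graph_mean_reaches_bounds: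
  fixes d :: "'a \<Rightarrow> real" and q :: "'a set \<Rightarrow> real"
  assumes "finite R" "finite U" "R \<inter> U = {}" and "\<And>v. v \<in> R \<union> U \<Longrightarrow> 0 < d v" and p: "0 \<le> p"
    and "finite B" "\<And>e. e \<in> B \<Longrightarrow> 0 \<le> q e \<and> q e \<le> 1"
    and "\<And>x y. x \<in> R \<union> U \<Longrightarrow> y \<in> U \<Longrightarrow> x \<noteq> y \<Longrightarrow> {x, y} \<in> B \<and> q {x, y} = 1 - exp (- (d x * d y * p))"
  shows "forest_poly p d R U * exp (- (p * (sum d R + sum d U)\<^sup>2)) \<le> graph_mean q B (\<lambda>G. of_bool (reaches R U G)) \<and>
    graph_mean q B (\<lambda>G. of_bool (reaches R U G)) \<le> forest_poly p d R U"
  using assms(1-4,6-)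
\<comment> \<open>\<open>B\<close> is generalised because each step removes the star of the explored
  root from it. The measure drops, as \<open>r\<close> is discarded while \<open>A\<close> only
  moves from \<open>U\<close> to the roots.\<close>
proof (induction "card R + card U" arbitrary: R U B rule: less_induct)
  case less
  note fin = less.prems(1,2) and disj = less.prems(3) and pos = less.prems(4) and B = less.prems(5)
    and q01 = less.prems(6) and q = less.prems(7)
  have D0: "0 \<le> sum d R + sum d U"
    using pos by (intro add_nonneg_nonneg sum_nonneg) (auto intro: less_imp_le)
  consider "U = {}" | "U \<noteq> {}" "R = {}" | r where "U \<noteq> {}" "r \<in> R" by blast
  then show ?case
  proof cases
    case 1
    then show ?thesis using graph_mean_const[OF B, of q 1] p by (simp add: reaches_def forest_poly_def)
  next
    case 2
    then have "\<not> reaches R U G" for G by (auto simp: reaches_def)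
    then show ?thesis using 2 graph_mean_const[OF B, of q 0] by (simp add: forest_poly_def)
  next
    case 3
    define star where "star = (\<lambda>u. {r, u}) ` U"
    define B' where "B' = B - star"
    define R' where "R' A = R - {r} \<union> A" for A
    define f where "f A = graph_mean q B' (\<lambda>H. of_bool (reaches (R' A) (U - A) H))" for A
    define qr where "qr u = q {r, u}" for u
    let ?D = "sum d R + sum d U"
    have rU: "r \<notin> U" using 3 disj by blast
    have rq: "{r, u} \<in> B \<and> q {r, u} = 1 - exp (- (d r * d u * p))" if "u \<in> U" for u
      using that 3 rU by (intro q) auto
    have inj: "inj_on (\<lambda>u. {r, u}) U" by (auto simp: inj_on_def doubleton_eq_iff)
    have BB: "B = star \<union> B'" using rq by (auto simp: star_def B'_def)
    have fB: "finite star" "finite B'" using fin B by (auto simp: star_def B'_def)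
    \<comment> \<open>The star of \<open>r\<close> is revealed first; given its leaves
      \<open>A\<close>, what remains concerns \<open>B'\<close> only.\<close>
    have mean: "graph_mean q B (\<lambda>G. of_bool (reaches R U G)) = graph_mean qr U f"
    proof -
      have "graph_mean q B (\<lambda>G. of_bool (reaches R U G)) =
        graph_mean q star (\<lambda>G. graph_mean q B' (\<lambda>H. of_bool (reaches R U (G \<union> H))))"
        unfolding BB by (rule graph_mean_Un[OF fB]) (auto simp: B'_def)
      also have "\<dots> = graph_mean qr U (\<lambda>A. graph_mean q B' (\<lambda>H. of_bool (reaches R U ((\<lambda>u. {r, u}) ` A \<union> H))))"
        unfolding star_def qr_def by (rule graph_mean_image[OF inj])
      also have "\<dots> = graph_mean qr U f"
      proof (intro graph_mean_cong)
        fix A assume A: "A \<subseteq> U"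
        show "graph_mean q B' (\<lambda>H. of_bool (reaches R U ((\<lambda>u. {r, u}) ` A \<union> H))) = f A"
          unfolding f_def
        proof (intro graph_mean_cong)
          fix H assume "H \<subseteq> B'"
          then have "{r, u} \<notin> H" if "u \<in> U" for u using that by (auto simp: B'_def star_def)
          from reaches_explore[OF disj 3(2) A this]
          show "of_bool (reaches R U ((\<lambda>u. {r, u}) ` A \<union> H)) = (of_bool (reaches (R' A) (U - A) H) :: real)"
            by (simp add: R'_def)
        qed
      qed
      finally show ?thesis .
    qed
    have IH: "forest_poly p d (R' A) (U - A) * exp (- (p * (?D - d r)\<^sup>2)) \<le> f A"
      "f A \<le> forest_poly p d (R' A) (U - A)" if A: "A \<subseteq> U" for A
    proof -
      have fA: "finite A" using A fin finite_subset by blast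
      have RA: "finite (R' A)" "R' A \<inter> (U - A) = {}" "R' A \<union> (U - A) = R - {r} \<union> U"
        using fin fA disj A by (auto simp: R'_def)
      have "card (R' A) = card (R - {r}) + card A"
        unfolding R'_def using fin fA disj A by (intro card_Un_disjoint) auto
      moreover have "card (U - A) = card U - card A" "card A \<le> card U"
        using A fin fA by (auto simp: card_Diff_subset card_mono)
      moreover have "0 < card R" using fin 3 by (auto simp: card_gt_0_iff)
      ultimately have "card (R' A) + card (U - A) < card R + card U" using fin 3 by simp
      moreover have "sum d (R' A) + sum d (U - A) = ?D - d r"
      proof -
        have "sum d (R' A) + sum d (U - A) = sum d (R - {r} \<union> U)"
          unfolding RA(3)[symmetric] using RA fin by (intro sum.union_disjoint[symmetric]) auto
        also have "\<dots> = sum d (R - {r}) + sum d U"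
          using fin disj by (intro sum.union_disjoint) auto
        also have "sum d (R - {r}) = sum d R - d r" using fin 3 by (simp add: sum_diff1)
        finally show ?thesis by simp
      qed
      moreover have "{x, y} \<in> B' \<and> q {x, y} = 1 - exp (- (d x * d y * p))"
        if xy: "x \<in> R' A \<union> (U - A)" "y \<in> U - A" "x \<noteq> y" for x y
      proof -
        have "x \<in> R - {r} \<union> U" using xy(1) RA(3) by simp
        then have "{x, y} \<in> B \<and> q {x, y} = 1 - exp (- (d x * d y * p))" "{x, y} \<notin> star"
          using xy rU q[of x y] by (auto simp: star_def doubleton_eq_iff)
        then show ?thesis by (simp add: B'_def)
      qed
      ultimately show "forest_poly p d (R' A) (U - A) * exp (- (p * (?D - d r)\<^sup>2)) \<le> f A"
        "f A \<le> forest_poly p d (R' A) (U - A)"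
        using less.hyps[of "R' A" "U - A" B'] RA fin fB(2) pos q01 unfolding f_def RA(3)
        by (auto simp: B'_def)
    qed
    have F0: "0 \<le> forest_poly p d (R' A) (U - A)" if "A \<subseteq> U" for A
      using that pos p by (intro forest_poly_nonneg) (auto simp: R'_def)
    have dr: "0 < d r" using pos 3 by blast
    note qrw = star_weight_bounds[of U _ "d r" d p qr]
    have w: "graph_weight qr U A \<le> (\<Prod>a\<in>A. d r * d a * p)"
      "(\<Prod>a\<in>A. d r * d a * p) * exp (- (p * (d r * sum d U))) \<le> graph_weight qr U A" if "A \<subseteq> U" for A
      using qrw[OF fin(2) that dr] pos p rq by (auto simp: qr_def)
    have w0: "0 \<le> graph_weight qr U A" for A
    proof (rule graph_weight_nonneg)
      fix u assume "u \<in> U"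
      then show "0 \<le> qr u \<and> qr u \<le> 1" using q01[of "{r, u}"] rq by (simp only: qr_def)
    qed
    have pr0: "0 \<le> (\<Prod>a\<in>A. d r * d a * p)" if "A \<subseteq> U" for A
      using that dr pos p by (intro prod_nonneg) (auto simp: subset_iff intro!: mult_nonneg_nonneg intro: less_imp_le)
    have expl: "(\<Sum>A\<in>Pow U. (\<Prod>a\<in>A. d r * d a * p) * forest_poly p d (R' A) (U - A)) = forest_poly p d R U"
      unfolding R'_def using pos by (intro forest_poly_explore fin disj 3) auto
    have "graph_mean qr U f \<le> (\<Sum>A\<in>Pow U. (\<Prod>a\<in>A. d r * d a * p) * forest_poly p d (R' A) (U - A))"
      unfolding graph_mean_def
    proof (intro sum_mono)
      fix A assume "A \<in> Pow U"
      then have A: "A \<subseteq> U" by simp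
      have "f A * graph_weight qr U A \<le> forest_poly p d (R' A) (U - A) * (\<Prod>a\<in>A. d r * d a * p)"
        using IH(2)[OF A] w(1)[OF A] F0[OF A] w0 by (intro mult_mono) auto
      then show "f A * graph_weight qr U A \<le> (\<Prod>a\<in>A. d r * d a * p) * forest_poly p d (R' A) (U - A)"
        by (simp add: mult.commute)
    qed
    then have upper: "graph_mean qr U f \<le> forest_poly p d R U" using expl by simp
    \<comment> \<open>The induction hypothesis has total \<open>?D - d r\<close> and the star costs
      \<open>d r * sum d U\<close>; the drop from the square of \<open>?D\<close> pays for this
      cost.\<close>
    have e: "exp (- (p * ?D\<^sup>2)) \<le> exp (- (p * (?D - d r)\<^sup>2)) * exp (- (p * (d r * sum d U)))"
    proof -
      have le: "d r \<le> sum d R" using fin 3 pos by (intro member_le_sum) (auto intro: less_imp_le)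
      have "0 \<le> sum d U" using pos by (intro sum_nonneg) (auto intro: less_imp_le)
      have "(?D - d r)\<^sup>2 + d r * sum d U = ?D\<^sup>2 - d r * (2 * sum d R - d r + sum d U)"
        by (simp add: power2_eq_square algebra_simps)
      moreover have "0 \<le> d r * (2 * sum d R - d r + sum d U)"
        using le dr \<open>0 \<le> sum d U\<close> by (intro mult_nonneg_nonneg) auto
      ultimately have "p * ((?D - d r)\<^sup>2 + d r * sum d U) \<le> p * ?D\<^sup>2"
        using p by (intro mult_left_mono) auto
      then show ?thesis by (simp add: exp_add[symmetric] algebra_simps)
    qed
    have "forest_poly p d R U * exp (- (p * ?D\<^sup>2)) =
      (\<Sum>A\<in>Pow U. (\<Prod>a\<in>A. d r * d a * p) * forest_poly p d (R' A) (U - A) * exp (- (p * ?D\<^sup>2)))"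
      by (simp only: expl[symmetric] sum_distrib_right)
    also have "\<dots> \<le> graph_mean qr U f"
      unfolding graph_mean_def
    proof (intro sum_mono)
      fix A assume "A \<in> Pow U"
      then have A: "A \<subseteq> U" by simp
      have "(\<Prod>a\<in>A. d r * d a * p) * forest_poly p d (R' A) (U - A) * exp (- (p * ?D\<^sup>2)) \<le>
        (\<Prod>a\<in>A. d r * d a * p) * forest_poly p d (R' A) (U - A) *
        (exp (- (p * (?D - d r)\<^sup>2)) * exp (- (p * (d r * sum d U))))"
        using pr0[OF A] F0[OF A] e by (intro mult_left_mono mult_nonneg_nonneg)
      also have "\<dots> = (forest_poly p d (R' A) (U - A) * exp (- (p * (?D - d r)\<^sup>2))) *
        ((\<Prod>a\<in>A. d r * d a * p) * exp (- (p * (d r * sum d U))))"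
        by (simp only: ac_simps)
      also have "\<dots> \<le> f A * graph_weight qr U A"
        using IH(1)[OF A] w(2)[OF A] pr0[OF A] F0[OF A]
        by (intro mult_mono) (auto intro!: order_trans[OF _ IH(1)[OF A]] mult_nonneg_nonneg)
      finally show "(\<Prod>a\<in>A. d r * d a * p) * forest_poly p d (R' A) (U - A) * exp (- (p * ?D\<^sup>2)) \<le>
        f A * graph_weight qr U A" .
    qed
    finally show ?thesis using upper mean by simp
  qed
qed

text \<open>The two conditions concern disjoint sets of edges, those leaving \<open>S\<close> and
  those inside \<open>S\<close>, and so become independent in a random graph.\<close>

lemma component_iff_reaches:
  assumes S: "S \<subseteq> V" "v \<in> S" and G: "\<And>x y. {x, y} \<in> G \<Longrightarrow> x \<in> V \<and> y \<in> V"
  shows "S \<in> graph_components V G \<longleftrightarrow>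
    (\<lambda>(x, y). {x, y}) ` (S \<times> (V - S)) \<inter> G = {} \<and> reaches {v} (S - {v}) G"
proof -
  let ?r = "{(x, y). {x, y} \<in> G \<and> y \<in> S - {v}}"
  have vV: "v \<in> V" using S by blast
  show ?thesis
  proof
    assume "S \<in> graph_components V G"
    then obtain w where "w \<in> V" "S = graph_component V G w" by (auto simp: graph_components_def)
    then have Sv: "S = graph_component V G v" using S(2) component_eqI[of v V G w] by simp
    have crossing: "{x, y} \<notin> G" if "x \<in> S" "y \<in> V - S" for x y
    proof
      assume xy: "{x, y} \<in> G"
      have "(v, x) \<in> (edge_rel G)\<^sup>*" using that(1) unfolding Sv by (simp add: graph_component_def)
      moreover have "(x, y) \<in> edge_rel G" using xy by (simp add: edge_rel_def)
      ultimately have "(v, y) \<in> (edge_rel G)\<^sup>*" by (rule rtrancl_into_rtrancl)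
      then have "y \<in> S" using that(2) unfolding Sv by (simp add: graph_component_def)
      then show False using that(2) by simp
    qed
    have "(v, u) \<in> ?r\<^sup>* \<and> u \<in> S" if "(v, u) \<in> (edge_rel G)\<^sup>*" for u
      using that
    proof (induction rule: rtrancl_induct)
      case base
      then show ?case using S by simp
    next
      case (step y z)
      have yz: "{y, z} \<in> G" using step.hyps by (simp add: edge_rel_def)
      then have zS: "z \<in> S" using crossing[of y z] G[OF yz] step.IH by blast
      show ?case
      proof (cases "z = v")
        case False
        then have "(y, z) \<in> ?r" using yz zS by simp
        then show ?thesis using step.IH zS by (meson rtrancl_into_rtrancl)
      qed (use zS in simp)
    qed
    moreover have "(v, u) \<in> (edge_rel G)\<^sup>*" if "u \<in> S" for u
      using that unfolding Sv by (simp add: graph_component_def)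
    ultimately have "reaches {v} (S - {v}) G" unfolding reaches_def by blast
    then show "(\<lambda>(x, y). {x, y}) ` (S \<times> (V - S)) \<inter> G = {} \<and> reaches {v} (S - {v}) G"
      using crossing by auto
  next
    assume R: "(\<lambda>(x, y). {x, y}) ` (S \<times> (V - S)) \<inter> G = {} \<and> reaches {v} (S - {v}) G"
    have sub: "?r\<^sup>* \<subseteq> (edge_rel G)\<^sup>*" by (intro rtrancl_mono) (auto simp: edge_rel_def)
    have "(v, u) \<in> (edge_rel G)\<^sup>*" if "u \<in> S" for u
    proof (cases "u = v")
      case False
      then have "(v, u) \<in> ?r\<^sup>*" using R that by (auto simp: reaches_def)
      then show ?thesis using sub by blast
    qed simp
    moreover have "u \<in> S" if "(v, u) \<in> (edge_rel G)\<^sup>*" for u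
      using that
    proof (induction rule: rtrancl_induct)
      case base
      then show ?case using S by simp
    next
      case (step y z)
      have yz: "{y, z} \<in> G" using step.hyps by (simp add: edge_rel_def)
      show ?case
      proof (rule ccontr)
        assume "z \<notin> S"
        then have "(y, z) \<in> S \<times> (V - S)" using step.IH G[OF yz] by simp
        then have "{y, z} \<in> (\<lambda>(x, y). {x, y}) ` (S \<times> (V - S))" by (rule rev_image_eqI) simp
        then show False using R yz by blast
      qed
    qed
    ultimately have "S = graph_component V G v" using S by (auto simp: graph_component_def)
    then show "S \<in> graph_components V G" using vV by (simp add: graph_components_def)
  qed
qed

section \<open>Few components are large\<close>

lemma card_components_le_small:
  assumes "finite V" "0 < (K :: real)"
  shows "real (card (graph_components V G)) \<le>
    real (card {S \<in> graph_components V G. real (card S) \<le> K}) + real (card V) / K"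
proof -
  let ?C = "graph_components V G"
  let ?B = "{S \<in> ?C. K < real (card S)}"
  note fin = finite_components[OF assms(1), of G]
  have "K * real (card ?B) = (\<Sum>S\<in>?B. K)" by simp
  also have "\<dots> \<le> (\<Sum>S\<in>?B. real (card S))" by (intro sum_mono) auto
  also have "\<dots> \<le> (\<Sum>S\<in>?C. real (card S))" using fin by (intro sum_mono2) auto
  also have "\<dots> = real (card V)" using sum_card_components[OF assms(1), of G] by (simp flip: of_nat_sum)
  finally have "real (card ?B) \<le> real (card V) / K" using assms(2) by (simp add: field_simps)
  moreover have "card ?C = card {S \<in> ?C. real (card S) \<le> K} + card ?B"
    using fin by (subst card_Un_disjoint[symmetric]) (auto intro!: arg_cong[of _ _ card])
  ultimately show ?thesis by simp
qed

text \<open>The sizes add up to \<open>card V\<close>, which leaves room for only one component with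
  more than half of the vertices. The \<open>+ 1\<close> is later cancelled by the
  \<open>- 1\<close> in \<open>excess_components\<close>.\<close>

lemma card_components_le_half:
  assumes "finite V"
  shows "card (graph_components V G) \<le> card {S \<in> graph_components V G. 2 * card S \<le> card V} + 1"
proof -
  let ?C = "graph_components V G"
  let ?B = "{S \<in> ?C. card V < 2 * card S}"
  note fin = finite_components[OF assms(1), of G]
  have "S = T" if "S \<in> ?B" "T \<in> ?B" for S T
  proof (rule ccontr)
    assume "S \<noteq> T"
    then have "(\<Sum>R\<in>{S, T}. card R) \<le> (\<Sum>R\<in>?C. card R)"
      using that fin by (intro sum_mono2) auto
    then show False using \<open>S \<noteq> T\<close> that sum_card_components[OF assms, of G] by auto
  qed
  then have "card ?B \<le> 1" using fin by (intro card_le_Suc0_iff_eq[THEN iffD2, folded One_nat_def]) auto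
  moreover have "card ?C = card {S \<in> ?C. 2 * card S \<le> card V} + card ?B"
    using fin by (subst card_Un_disjoint[symmetric]) (auto intro!: arg_cong[of _ _ card])
  ultimately show ?thesis by simp
qed

section \<open>Component probabilities for decomposable weights\<close>

locale decomposable_weights =
  fixes n :: nat and \<alpha> :: "nat set \<Rightarrow> real" and d :: "nat \<Rightarrow> real"
  assumes n_ge_1: "1 \<le> n"
    and decomposes: "decomposes n \<alpha> d"
    and d_pos: "v \<in> {1..n} \<Longrightarrow> 0 < d v"
begin

definition edge_prob :: "real \<Rightarrow> nat set \<Rightarrow> real" where
  "edge_prob p e = 1 - exp (- (\<alpha> e * p))"

definition component_prob :: "real \<Rightarrow> nat set \<Rightarrow> real" where
  "component_prob p S =
     graph_mean (edge_prob p) (complete_edges n) (\<lambda>G. of_bool (S \<in> graph_components {1..n} G))"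

text \<open>By Cayley's formula, the sum of \<open>\<Prod>e\<in>T. \<alpha> e\<close> over the spanning trees \<open>T\<close> of \<open>S\<close>.\<close>

definition tree_weight :: "nat set \<Rightarrow> real" where
  "tree_weight S = prod d S * sum d S ^ card S / (sum d S)\<^sup>2"

lemma weight_eq: "x \<in> {1..n} \<Longrightarrow> y \<in> {1..n} \<Longrightarrow> x \<noteq> y \<Longrightarrow> \<alpha> {x, y} = d x * d y"
  using decomposes by (simp add: decomposes_def)

lemma weight_pos: "e \<in> complete_edges n \<Longrightarrow> 0 < \<alpha> e"
  by (auto simp: complete_edges_def card_2_iff weight_eq d_pos)

lemma edge_prob_bounds:
  assumes "0 \<le> p" "e \<in> complete_edges n"
  shows "0 \<le> edge_prob p e \<and> edge_prob p e \<le> 1"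
  using assms weight_pos[OF assms(2)] by (simp add: edge_prob_def)

lemma sum_d_pos:
  assumes "S \<subseteq> {1..n}" "S \<noteq> {}"
  shows "0 < sum d S"
proof (rule sum_pos)
  show "finite S" using assms(1) finite_subset by blast
  show "0 < d v" if "v \<in> S" for v using d_pos[of v] that assms(1) by blast
qed (fact assms(2))

text \<open>Isolation of \<open>S\<close> is independent of connectedness within \<open>S\<close>.
  Decomposability makes the exponent of the isolation probability a product of two sums.\<close>

lemma component_prob_eq_reaches:
  assumes S: "S \<subseteq> {1..n}" "S \<noteq> {}" and p: "0 \<le> p" and v: "v \<in> S"
  defines "crossing \<equiv> (\<lambda>(x, y). {x, y}) ` (S \<times> ({1..n} - S))"
  shows "component_prob p S = exp (- (p * (sum d S * (sum d {1..n} - sum d S)))) *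
    graph_mean (edge_prob p) (complete_edges n - crossing) (\<lambda>G. of_bool (reaches {v} (S - {v}) G))"
proof -
  let ?E = "complete_edges n" and ?q = "edge_prob p"
  let ?f = "\<lambda>G. of_bool (reaches {v} (S - {v}) G) :: real"
  have crossing: "crossing \<subseteq> ?E" using S by (auto simp: crossing_def complete_edges_def card_insert_if)
  have fc: "finite crossing" using crossing finite_complete_edges finite_subset by blast
  have inj: "inj_on (\<lambda>(x, y). {x, y}) (S \<times> ({1..n} - S))"
    by (auto simp: inj_on_def doubleton_eq_iff)
  have wt: "\<alpha> {x, y} = d x * d y" if "x \<in> S" "y \<notin> S" "Suc 0 \<le> y" "y \<le> n" for x y
    using S that by (intro weight_eq) auto
  have EE: "?E = crossing \<union> (?E - crossing)" using crossing by blast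
  have comp: "S \<in> graph_components {1..n} G \<longleftrightarrow> crossing \<inter> G = {} \<and> reaches {v} (S - {v}) G"
    if G: "G \<subseteq> ?E" for G
    unfolding crossing_def using G by (intro component_iff_reaches S v) (auto simp: complete_edges_def)
  have "component_prob p S = graph_mean ?q (crossing \<union> (?E - crossing)) (\<lambda>G. of_bool (S \<in> graph_components {1..n} G))"
    unfolding component_prob_def using EE by simp
  also have "\<dots> = graph_mean ?q crossing (\<lambda>G. graph_mean ?q (?E - crossing)
      (\<lambda>H. of_bool (S \<in> graph_components {1..n} (G \<union> H))))"
    using fc finite_complete_edges by (intro graph_mean_Un) auto
  \<comment> \<open>A crossing edge prevents \<open>S\<close> from being a component, so only
    \<open>G = {}\<close> survives.\<close>
  also have "\<dots> = graph_mean ?q crossing (\<lambda>G. if G = {} then graph_mean ?q (?E - crossing) ?f else 0)"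
  proof (intro graph_mean_cong)
    fix G assume G: "G \<subseteq> crossing"
    have "of_bool (S \<in> graph_components {1..n} (G \<union> H)) = (if G = {} then ?f H else 0)"
      if H: "H \<subseteq> ?E - crossing" for H
    proof -
      have "G \<union> H \<subseteq> ?E" "crossing \<inter> (G \<union> H) = {} \<longleftrightarrow> G = {}" using G H crossing by blast+
      then show ?thesis using comp[of "G \<union> H"] by simp
    qed
    then have "graph_mean ?q (?E - crossing) (\<lambda>H. of_bool (S \<in> graph_components {1..n} (G \<union> H))) =
      graph_mean ?q (?E - crossing) (\<lambda>H. if G = {} then ?f H else 0)"
      by (intro graph_mean_cong) auto
    then show "graph_mean ?q (?E - crossing) (\<lambda>H. of_bool (S \<in> graph_components {1..n} (G \<union> H))) =
      (if G = {} then graph_mean ?q (?E - crossing) ?f else 0)"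
      by (cases "G = {}") (simp_all add: graph_mean_def)
  qed
  also have "\<dots> = graph_mean ?q (?E - crossing) ?f * graph_weight ?q crossing {}"
  proof -
    have "graph_mean ?q crossing (\<lambda>G. if G = {} then graph_mean ?q (?E - crossing) ?f else 0) =
      (\<Sum>G\<in>Pow crossing. if G = {} then graph_mean ?q (?E - crossing) ?f * graph_weight ?q crossing {} else 0)"
      unfolding graph_mean_def[of _ crossing] by (intro sum.cong) auto
    then show ?thesis using fc by (simp add: sum.delta)
  qed
  also have "graph_weight ?q crossing {} = (\<Prod>(x, y)\<in>S \<times> ({1..n} - S). exp (- (d x * d y * p)))"
    unfolding graph_weight_def crossing_def prod.reindex[OF inj] o_def
    using wt by (intro prod.cong) (auto simp: edge_prob_def)
  also have "\<dots> = exp (- (\<Sum>(x, y)\<in>S \<times> ({1..n} - S). d x * d y * p))"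
    using S finite_subset[OF S(1)] by (simp add: exp_sum[symmetric] sum_negf case_prod_unfold)
  also have "(\<Sum>(x, y)\<in>S \<times> ({1..n} - S). d x * d y * p) = p * (sum d S * sum d ({1..n} - S))"
    by (simp only: sum.cartesian_product[symmetric] sum_distrib_right[symmetric] sum_product[symmetric] mult.commute[of p])
  also have "sum d ({1..n} - S) = sum d {1..n} - sum d S"
    using S by (intro sum_diff) auto
  finally show ?thesis by (simp add: mult.commute)
qed

text \<open>The first bound keeps only the isolation of \<open>S\<close>, which suffices for large
  \<open>p\<close>; the other two add the forest bounds with a single root \<open>v\<close>.\<close>

lemma component_prob_bounds:
  assumes S: "S \<subseteq> {1..n}" "S \<noteq> {}" and p: "0 \<le> p"
  defines "D \<equiv> sum d {1..n}"
  shows "component_prob p S \<le> exp (- (p * (sum d S * (D - sum d S))))"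
    and "component_prob p S \<le> tree_weight S * p ^ (card S - 1) * exp (- (p * (sum d S * (D - sum d S))))"
    and "tree_weight S * p ^ (card S - 1) * exp (- (p * (sum d S * D))) \<le> component_prob p S"
proof -
  obtain v where v: "v \<in> S" using S by blast
  have finS: "finite S" using S finite_subset by blast
  define crossing where "crossing = (\<lambda>(x, y). {x, y}) ` (S \<times> ({1..n} - S))"
  define B where "B = complete_edges n - crossing"
  define m where "m = graph_mean (edge_prob p) B (\<lambda>G. of_bool (reaches {v} (S - {v}) G))"
  let ?x = "exp (- (p * (sum d S * (D - sum d S))))"
  have eq: "component_prob p S = ?x * m"
    using component_prob_eq_reaches[OF S p v] by (simp add: D_def m_def B_def crossing_def)
  have B: "finite B" "\<And>e. e \<in> B \<Longrightarrow> 0 \<le> edge_prob p e \<and> edge_prob p e \<le> 1"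
    using finite_complete_edges edge_prob_bounds[OF p] by (auto simp: B_def)
  have "m \<le> graph_mean (edge_prob p) B (\<lambda>_. 1)"
    unfolding m_def using B(2) by (intro graph_mean_mono) auto
  then have "m \<le> 1" using graph_mean_const[OF B(1), of "edge_prob p" 1] by simp
  then show "component_prob p S \<le> ?x" using eq by simp
  have dS: "sum d {v} + sum d (S - {v}) = sum d S" using finS v by (simp add: sum.remove)
  have "{x, y} \<in> B \<and> edge_prob p {x, y} = 1 - exp (- (d x * d y * p))"
    if "x \<in> {v} \<union> (S - {v})" "y \<in> S - {v}" "x \<noteq> y" for x y
  proof -
    have xy: "x \<in> S" "y \<in> S" "x \<in> {1..n}" "y \<in> {1..n}" using that v S by auto
    then have "{x, y} \<in> complete_edges n" using that by (simp add: complete_edges_def)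
    moreover have "{x, y} \<notin> crossing" using xy by (auto simp: crossing_def doubleton_eq_iff)
    ultimately show ?thesis using weight_eq[OF xy(3,4) that(3)] by (simp add: B_def edge_prob_def)
  qed
  moreover have "0 < d u" if "u \<in> {v} \<union> (S - {v})" for u
    using that v S d_pos by blast
  ultimately have b: "forest_poly p d {v} (S - {v}) * exp (- (p * (sum d S)\<^sup>2)) \<le> m"
    "m \<le> forest_poly p d {v} (S - {v})"
    unfolding m_def dS[symmetric] using graph_mean_reaches_bounds[of "{v}" "S - {v}" d p B "edge_prob p"] finS p B
    by auto
  \<comment> \<open>Division by the square in \<open>tree_weight\<close> stands for the exponent
    \<open>card S - 2\<close>, which is negative for a singleton; hence the separate case.\<close>
  have F: "forest_poly p d {v} (S - {v}) = tree_weight S * p ^ (card S - 1)"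
  proof (cases "S = {v}")
    case True
    then show ?thesis using sum_d_pos[OF S] by (simp add: forest_poly_def tree_weight_def power2_eq_square)
  next
    case False
    then have ne: "S - {v} \<noteq> {}" using v by blast
    obtain k where k: "card S = Suc (Suc k)"
    proof -
      have "card (S - {v}) \<noteq> 0" using ne finS by (simp only: card_eq_0_iff finite_Diff) simp
      moreover have "card (S - {v}) = card S - 1" using v by simp
      ultimately show ?thesis using that[of "card S - 2"] by linarith
    qed
    have "prod d S = d v * prod d (S - {v})" using finS v by (rule prod.remove)
    then show ?thesis using ne finS v dS sum_d_pos[OF S]
      by (simp add: forest_poly_def tree_weight_def k power2_eq_square)
  qed
  show "component_prob p S \<le> tree_weight S * p ^ (card S - 1) * ?x"
    unfolding eq using b(2) by (simp add: F mult.commute)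
  \<comment> \<open>The loss of the exploration and the isolation factor add up to exactly
    \<open>sum d S * D\<close>, whose integral is the series term without error.\<close>
  have "exp (- (p * (sum d S * D))) = exp (- (p * (sum d S)\<^sup>2)) * ?x"
    by (simp add: exp_add[symmetric] power2_eq_square algebra_simps)
  then have "tree_weight S * p ^ (card S - 1) * exp (- (p * (sum d S * D))) =
    forest_poly p d {v} (S - {v}) * exp (- (p * (sum d S)\<^sup>2)) * ?x" by (simp add: F)
  also have "\<dots> \<le> m * ?x" using b(1) by (intro mult_right_mono) auto
  finally show "tree_weight S * p ^ (card S - 1) * exp (- (p * (sum d S * D))) \<le> component_prob p S"
    unfolding eq by (simp add: mult.commute)
qed

lemma mean_excess_eq:
  "mean_excess n \<alpha> p = graph_mean (edge_prob p) (complete_edges n) (\<lambda>G. real (excess_components n G))"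
  by (simp add: mean_excess_def graph_mean_def edge_prob_def[abs_def])

lemma card_components_filter_eq_sum:
  "real (card {S \<in> graph_components {1..n} G. P S}) =
    (\<Sum>S | S \<subseteq> {1..n} \<and> S \<noteq> {} \<and> P S. of_bool (S \<in> graph_components {1..n} G))"
proof -
  have "{S. S \<subseteq> {1..n} \<and> S \<noteq> {} \<and> P S} \<inter> {S. S \<in> graph_components {1..n} G} =
    {S \<in> graph_components {1..n} G. P S}"
    using components_subset components_nonempty by fastforce
  moreover have "finite {S. S \<subseteq> {1..n} \<and> S \<noteq> {} \<and> P S}"
    by (rule finite_subset[of _ "Pow {1..n}"]) auto
  ultimately show ?thesis by (simp add: of_bool_def sum.If_cases)
qed

lemma card_components_ge_1: "1 \<le> card (graph_components {1..n} G)"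
  using n_ge_1 by (simp add: Suc_le_eq card_gt_0_iff finite_components) (simp add: graph_components_def)

lemma sum_component_prob:
  "(\<Sum>S | S \<subseteq> {1..n} \<and> S \<noteq> {}. component_prob p S) = mean_excess n \<alpha> p + 1"
proof -
  have "(\<Sum>S | S \<subseteq> {1..n} \<and> S \<noteq> {}. component_prob p S) =
    graph_mean (edge_prob p) (complete_edges n) (\<lambda>G. real (excess_components n G) + 1)"
    unfolding component_prob_def graph_mean_sum[symmetric]
    using card_components_filter_eq_sum[of _ "\<lambda>_. True"] card_components_ge_1
    by (intro graph_mean_cong) (simp add: excess_components_def of_nat_diff)
  also have "\<dots> = mean_excess n \<alpha> p + 1"
    by (simp only: graph_mean_add graph_mean_const[OF finite_complete_edges] mean_excess_eq)
  finally show ?thesis .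
qed

lemma mean_excess_nonneg: "0 \<le> p \<Longrightarrow> 0 \<le> mean_excess n \<alpha> p"
  unfolding mean_excess_eq graph_mean_def using edge_prob_bounds
  by (intro sum_nonneg mult_nonneg_nonneg graph_weight_nonneg) auto

lemma mean_excess_le_small:
  assumes "0 \<le> p" "0 < K"
  shows "mean_excess n \<alpha> p \<le>
    (\<Sum>S | S \<subseteq> {1..n} \<and> S \<noteq> {} \<and> real (card S) \<le> K. component_prob p S) + real n / K"
proof -
  have "mean_excess n \<alpha> p \<le> graph_mean (edge_prob p) (complete_edges n)
    (\<lambda>G. (\<Sum>S | S \<subseteq> {1..n} \<and> S \<noteq> {} \<and> real (card S) \<le> K. of_bool (S \<in> graph_components {1..n} G)) + real n / K)"
    unfolding mean_excess_eq
  proof (intro graph_mean_mono)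
    fix G :: "nat set set"
    show "real (excess_components n G) \<le>
      (\<Sum>S | S \<subseteq> {1..n} \<and> S \<noteq> {} \<and> real (card S) \<le> K. of_bool (S \<in> graph_components {1..n} G)) + real n / K"
      using card_components_le_small[of "{1..n}" K G] assms(2) card_components_filter_eq_sum[of G "\<lambda>S. real (card S) \<le> K"]
      by (simp add: excess_components_def)
  qed (use edge_prob_bounds assms in auto)
  then show ?thesis
    by (simp only: graph_mean_add graph_mean_const[OF finite_complete_edges] graph_mean_sum component_prob_def)
qed

lemma mean_excess_le_half:
  assumes "0 \<le> p"
  shows "mean_excess n \<alpha> p \<le> (\<Sum>S | S \<subseteq> {1..n} \<and> S \<noteq> {} \<and> 2 * card S \<le> n. component_prob p S)"
proof -
  have "mean_excess n \<alpha> p \<le> graph_mean (edge_prob p) (complete_edges n)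
    (\<lambda>G. \<Sum>S | S \<subseteq> {1..n} \<and> S \<noteq> {} \<and> 2 * card S \<le> n. of_bool (S \<in> graph_components {1..n} G))"
    unfolding mean_excess_eq
  proof (intro graph_mean_mono)
    fix G :: "nat set set"
    show "real (excess_components n G) \<le>
      (\<Sum>S | S \<subseteq> {1..n} \<and> S \<noteq> {} \<and> 2 * card S \<le> n. of_bool (S \<in> graph_components {1..n} G))"
      using card_components_le_half[of "{1..n}" G] card_components_filter_eq_sum[of G "\<lambda>S. 2 * card S \<le> n"]
      by (simp add: excess_components_def)
  qed (use edge_prob_bounds assms in auto)
  then show ?thesis
    by (simp only: graph_mean_sum component_prob_def)
qed

end

section \<open>Asymptotics of the component counts\<close>

text \<open>Otherwise the simplifier turns \<open>{1..n}\<close> into \<open>{Suc 0..n}\<close>.\<close>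

declare One_nat_def [simp del]

lemma nn_integral_power_exp:
  fixes l :: real
  assumes "0 < l"
  shows "(\<integral>\<^sup>+p. indicator {0..} p * ennreal (p ^ j * exp (- (l * p))) \<partial>lborel) = ennreal (fact j / l ^ Suc j)"
proof -
  \<comment> \<open>\<open>erlang_density 0 l\<close> is the exponential density of rate
    \<open>l\<close>.\<close>
  have "(\<integral>\<^sup>+p. indicator {0..} p * ennreal (p ^ j * exp (- (l * p))) \<partial>lborel) =
    (\<integral>\<^sup>+p. ennreal (1 / l) * ennreal (erlang_density 0 l p * p ^ j) \<partial>lborel)"
    using assms by (intro nn_integral_cong)
      (auto simp: erlang_density_def ennreal_mult'[symmetric] indicator_def)
  also have "\<dots> = ennreal (1 / l) * (\<integral>\<^sup>+p. ennreal (erlang_density 0 l p * p ^ j) \<partial>lborel)"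
    by (intro nn_integral_cmult) simp
  also have "\<dots> = ennreal (1 / l) * ennreal (fact j / l ^ j)"
    using nn_integral_erlang_ith_moment[OF assms, of 0 j] by simp
  also have "\<dots> = ennreal (fact j / l ^ Suc j)"
    using assms by (simp add: ennreal_mult'[symmetric])
  finally show ?thesis .
qed

text \<open>The chain is (1 + x)^n - 1 <= exp (n x) - 1 <= n x exp (n x) <= e n x. It sums the
  isolation bounds over vertex sets at large \<open>p\<close>.\<close>

lemma sum_Pow_nonempty_power_le:
  fixes x :: real
  assumes "0 \<le> x" "real n * x \<le> 1"
  shows "(\<Sum>S | S \<subseteq> {1..n} \<and> S \<noteq> {}. x ^ card S) \<le> exp 1 * real n * x"
proof -
  have "{S. S \<subseteq> {1..n} \<and> S \<noteq> {}} = Pow {1..n} - {{}}" by auto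
  then have "(\<Sum>S | S \<subseteq> {1..n} \<and> S \<noteq> {}. x ^ card S) = (x + 1) ^ n - 1"
    using sum_Pow_power[of "{1..n}" x 1] by (simp add: sum_diff1)
  also have "(x + 1) ^ n \<le> exp x ^ n"
    using assms(1) exp_ge_add_one_self[of x] by (intro power_mono) (auto simp: add.commute)
  also have "exp x ^ n = exp (real n * x)" by (simp add: exp_of_nat_mult)
  also have "exp (real n * x) - 1 \<le> real n * x * exp (real n * x)"
  proof -
    have "exp (real n * x) * (1 - exp (- (real n * x))) \<le> exp (real n * x) * (real n * x)"
      using assms by (intro mult_left_mono one_minus_exp_bounds) auto
    then show ?thesis by (simp add: algebra_simps exp_add[symmetric])
  qed
  also have "real n * x * exp (real n * x) \<le> real n * x * exp 1"
    using assms by (intro mult_left_mono) auto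
  finally show ?thesis by (simp add: ac_simps)
qed

section \<open>Integrated bounds for weights in a bounded range\<close>

locale bounded_weights = decomposable_weights +
  fixes w :: real
  assumes w_ge_1: "1 \<le> w"
    and d_bounds: "v \<in> {1..n} \<Longrightarrow> d v \<in> {inverse w..w}"
begin

definition "D \<equiv> sum d {1..n}"

definition tree_term :: "nat set \<Rightarrow> real" where
  "tree_term S = fact (card S - 1) / D ^ card S * (prod d S / (sum d S)\<^sup>2)"

definition "tree_sum \<equiv> \<Sum>S | S \<subseteq> {1..n} \<and> S \<noteq> {}. tree_term S"

definition "mst_integral \<equiv> \<integral>\<^sup>+p. indicator {0..} p * ennreal (mean_excess n \<alpha> p) \<partial>lborel"

lemma finite_subsets: "finite {S. S \<subseteq> {1..n} \<and> P S}"
  by (rule finite_subset[of _ "Pow {1..n}"]) auto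

lemma finite_subset_V: "S \<subseteq> {1..n} \<Longrightarrow> finite S"
  using finite_subset by blast

lemma D_pos: "0 < D"
  using n_ge_1 by (simp add: D_def sum_d_pos)

lemma sum_d_ge: "S \<subseteq> {1..n} \<Longrightarrow> real (card S) / w \<le> sum d S"
  using sum_bounded_below[of S "inverse w" d] d_bounds by (fastforce simp: divide_inverse)

lemma sum_d_le: "S \<subseteq> {1..n} \<Longrightarrow> sum d S \<le> real (card S) * w"
  using sum_bounded_above[of S d w] d_bounds by fastforce

lemma D_ge: "real n / w \<le> D"
  using sum_d_ge[of "{1..n}"] by (simp add: D_def)

lemma D_diff: "S \<subseteq> {1..n} \<Longrightarrow> D - sum d S = sum d ({1..n} - S)"
  unfolding D_def by (intro sum_diff[symmetric]) auto

lemma tree_weight_nonneg: "S \<subseteq> {1..n} \<Longrightarrow> 0 \<le> tree_weight S"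
  unfolding tree_weight_def
  by (intro divide_nonneg_nonneg mult_nonneg_nonneg prod_nonneg zero_le_power sum_nonneg)
    (auto intro: less_imp_le[OF d_pos])

lemma tree_term_nonneg: "S \<subseteq> {1..n} \<Longrightarrow> 0 \<le> tree_term S"
  unfolding tree_term_def using D_pos
  by (intro mult_nonneg_nonneg divide_nonneg_nonneg prod_nonneg) (auto intro: less_imp_le[OF d_pos])

lemma tree_sum_nonneg: "0 \<le> tree_sum"
  unfolding tree_sum_def by (intro sum_nonneg) (auto intro: tree_term_nonneg)

text \<open>A Gamma integral. The factor \<open>b\<close> is 1 for the series itself, 1/2 for its
  tail and 1 - d_S / D for the upper bound.\<close>

lemma tree_weight_integral:
  assumes S: "S \<subseteq> {1..n}" "S \<noteq> {}" and b: "0 < b"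
  shows "(\<integral>\<^sup>+p. indicator {0..} p * ennreal (tree_weight S * p ^ (card S - 1) * exp (- (p * (sum d S * (D * b))))) \<partial>lborel) =
    ennreal (tree_term S / b ^ card S)"
proof -
  have dS: "0 < sum d S" by (rule sum_d_pos[OF S])
  obtain k where k: "card S = Suc k"
    using S finite_subset_V[OF S(1)] by (metis card_eq_0_iff not0_implies_Suc)
  have "(\<integral>\<^sup>+p. indicator {0..} p * ennreal (tree_weight S * p ^ (card S - 1) * exp (- (p * (sum d S * (D * b))))) \<partial>lborel) =
    (\<integral>\<^sup>+p. ennreal (tree_weight S) * (indicator {0..} p * ennreal (p ^ k * exp (- (sum d S * (D * b) * p)))) \<partial>lborel)"
    using tree_weight_nonneg[OF S(1)]
    by (intro nn_integral_cong) (auto simp: k indicator_def ennreal_mult'[symmetric] ac_simps)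
  also have "\<dots> = ennreal (tree_weight S) * ennreal (fact k / (sum d S * (D * b)) ^ Suc k)"
    using dS D_pos b by (subst nn_integral_cmult) (auto simp: nn_integral_power_exp)
  also have "\<dots> = ennreal (tree_weight S * (fact k / (sum d S * (D * b)) ^ Suc k))"
    using tree_weight_nonneg[OF S(1)] by (simp add: ennreal_mult'[symmetric])
  also have "tree_weight S * (fact k / (sum d S * (D * b)) ^ Suc k) = tree_term S / b ^ card S"
    using dS D_pos b by (simp add: tree_weight_def tree_term_def k power_mult_distrib divide_simps)
  finally show ?thesis .
qed

text \<open>Singletons alone suffice: each contributes 1 / (D d_v), at least 1 / (n w^2). This turns
  absolute errors into relative ones.\<close>

lemma tree_sum_ge: "1 / w\<^sup>2 \<le> tree_sum"
proof -
  have "1 / w\<^sup>2 \<le> (\<Sum>v\<in>{1..n}. tree_term {v})"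
  proof -
    have "1 / (real n * w\<^sup>2) \<le> tree_term {v}" if v: "v \<in> {1..n}" for v
    proof -
      have "D * d v \<le> (real n * w) * w"
        using sum_d_le[of "{1..n}"] d_bounds[OF v] D_pos d_pos[OF v] w_ge_1
        by (intro mult_mono) (auto simp: D_def)
      then have "1 / (real n * w\<^sup>2) \<le> 1 / (D * d v)"
        using D_pos d_pos[OF v] n_ge_1 w_ge_1
        by (intro divide_left_mono) (auto simp: power2_eq_square ac_simps)
      also have "\<dots> = tree_term {v}"
        using D_pos d_pos[OF v] by (simp add: tree_term_def power2_eq_square)
      finally show ?thesis .
    qed
    then have "(\<Sum>v\<in>{1..n}. 1 / (real n * w\<^sup>2)) \<le> (\<Sum>v\<in>{1..n}. tree_term {v})"
      by (intro sum_mono)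
    then show ?thesis using n_ge_1 by simp
  qed
  also have "\<dots> = (\<Sum>S\<in>(\<lambda>v. {v}) ` {1..n}. tree_term S)"
    by (subst sum.reindex) auto
  also have "\<dots> \<le> tree_sum"
    unfolding tree_sum_def using finite_subsets
    by (intro sum_mono2) (auto intro: tree_term_nonneg)
  finally show ?thesis .
qed

lemma borel_measurable_mean_excess [measurable]: "mean_excess n \<alpha> \<in> borel_measurable borel"
  unfolding mean_excess_def[abs_def] graph_weight_def by measurable

text \<open>Summed over \<open>S\<close>, the lower bounds estimate the mean of kappa, one more than
  the integrand. On \<open>{0..p1}\<close> this surplus costs \<open>p1\<close>; beyond
  \<open>p1\<close> the integral of the lower bounds is itself a small part of
  \<open>tree_sum\<close>.\<close>

lemma tree_sum_le_mst_integral: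
  assumes p1: "0 \<le> p1" and \<epsilon>: "2 * exp (- (p1 * real n / (2 * w\<^sup>2))) \<le> 1" (is "?\<epsilon> \<le> 1")
  shows "ennreal tree_sum \<le> mst_integral + ennreal p1 + ennreal (?\<epsilon> * tree_sum)"
proof -
  let ?I = "{S. S \<subseteq> {1..n} \<and> S \<noteq> {}}"
  let ?t = "\<lambda>p S. tree_weight S * p ^ (card S - 1)"
  have t0: "0 \<le> ?t p S" if "S \<subseteq> {1..n}" "0 \<le> p" for p S
    using that tree_weight_nonneg by simp
  have pw: "indicator {0..} p * (\<Sum>S\<in>?I. ennreal (?t p S * exp (- (p * (sum d S * D))))) \<le>
    indicator {0..} p * ennreal (mean_excess n \<alpha> p) + indicator {0..p1} p +
    (\<Sum>S\<in>?I. ennreal (exp (- (p1 * (sum d S * D) / 2))) *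
      (indicator {0..} p * ennreal (?t p S * exp (- (p * (sum d S * (D * (1 / 2))))))))"
    (is "?lhs \<le> ?m + ?i + ?r") for p :: real
  proof (cases "0 \<le> p")
    case p: True
    have lhs: "?lhs = ennreal (\<Sum>S\<in>?I. ?t p S * exp (- (p * (sum d S * D))))"
    proof -
      have "(\<Sum>S\<in>?I. ennreal (?t p S * exp (- (p * (sum d S * D))))) =
        ennreal (\<Sum>S\<in>?I. ?t p S * exp (- (p * (sum d S * D))))"
        using p by (intro sum_ennreal mult_nonneg_nonneg[OF t0]) auto
      then show ?thesis using p by simp
    qed
    show ?thesis
    proof (cases "p \<le> p1")
      case True
      have "(\<Sum>S\<in>?I. ?t p S * exp (- (p * (sum d S * D)))) \<le> (\<Sum>S\<in>?I. component_prob p S)"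
        using component_prob_bounds(3)[OF _ _ p] by (intro sum_mono) (auto simp: D_def)
      also have "\<dots> = mean_excess n \<alpha> p + 1" by (rule sum_component_prob)
      finally have "?lhs \<le> ennreal (mean_excess n \<alpha> p + 1)" unfolding lhs by (rule ennreal_leI)
      also have "\<dots> = ?m + ?i" using p True mean_excess_nonneg[OF p] by (simp add: ennreal_plus)
      finally show ?thesis by (rule order_trans) simp
    next
      case False
      have "ennreal (?t p S * exp (- (p * (sum d S * D)))) \<le>
        ennreal (exp (- (p1 * (sum d S * D) / 2))) * ennreal (?t p S * exp (- (p * (sum d S * (D * (1 / 2))))))"
        if S: "S \<in> ?I" for S
      proof -
        \<comment> \<open>Half of the exponent is frozen at \<open>p1\<close> and yields the small
          factor; the other half remains to be integrated.\<close>
        have "p1 * (sum d S * D) \<le> p * (sum d S * D)"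
          using False sum_d_pos[of S] D_pos S by (intro mult_right_mono) auto
        then have "exp (- (p * (sum d S * D))) \<le> exp (- (p1 * (sum d S * D) / 2)) * exp (- (p * (sum d S * (D * (1 / 2)))))"
          by (simp add: exp_add[symmetric])
        from mult_left_mono[OF this t0[of S p]] show ?thesis
          using S p by (subst ennreal_mult'[symmetric]) (auto intro!: ennreal_leI simp: ac_simps)
      qed
      then have "(\<Sum>S\<in>?I. ennreal (?t p S * exp (- (p * (sum d S * D))))) \<le> (\<Sum>S\<in>?I.
        ennreal (exp (- (p1 * (sum d S * D) / 2))) * ennreal (?t p S * exp (- (p * (sum d S * (D * (1 / 2)))))))"
        by (rule sum_mono)
      then have "?lhs \<le> ?r" using p by simp
      then show ?thesis by (rule order_trans) simp
    qed
  qed simp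
  have "ennreal tree_sum = (\<Sum>S\<in>?I. ennreal (tree_term S))"
    unfolding tree_sum_def using tree_term_nonneg by (intro sum_ennreal[symmetric]) auto
  also have "\<dots> = (\<Sum>S\<in>?I. \<integral>\<^sup>+p. indicator {0..} p * ennreal (?t p S * exp (- (p * (sum d S * D)))) \<partial>lborel)"
    using tree_weight_integral[of _ 1] by (intro sum.cong) auto
  also have "\<dots> = (\<integral>\<^sup>+p. indicator {0..} p * (\<Sum>S\<in>?I. ennreal (?t p S * exp (- (p * (sum d S * D))))) \<partial>lborel)"
    unfolding sum_distrib_left by (intro nn_integral_sum[symmetric]) measurable
  also have "\<dots> \<le> (\<integral>\<^sup>+p. indicator {0..} p * ennreal (mean_excess n \<alpha> p) + indicator {0..p1} p +
    (\<Sum>S\<in>?I. ennreal (exp (- (p1 * (sum d S * D) / 2))) *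
      (indicator {0..} p * ennreal (?t p S * exp (- (p * (sum d S * (D * (1 / 2)))))))) \<partial>lborel)"
    by (intro nn_integral_mono pw)
  also have "\<dots> = mst_integral + ennreal p1 + (\<Sum>S\<in>?I. ennreal (exp (- (p1 * (sum d S * D) / 2))) *
      (\<integral>\<^sup>+p. indicator {0..} p * ennreal (?t p S * exp (- (p * (sum d S * (D * (1 / 2)))))) \<partial>lborel))"
    using p1 unfolding mst_integral_def
    by (simp add: nn_integral_add nn_integral_sum nn_integral_cmult)
  also have "(\<Sum>S\<in>?I. ennreal (exp (- (p1 * (sum d S * D) / 2))) *
      (\<integral>\<^sup>+p. indicator {0..} p * ennreal (?t p S * exp (- (p * (sum d S * (D * (1 / 2)))))) \<partial>lborel)) =
    (\<Sum>S\<in>?I. ennreal (exp (- (p1 * (sum d S * D) / 2)) * (tree_term S / (1 / 2) ^ card S)))"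
  proof (intro sum.cong refl)
    fix S assume "S \<in> ?I"
    then show "ennreal (exp (- (p1 * (sum d S * D) / 2))) *
        (\<integral>\<^sup>+p. indicator {0..} p * ennreal (?t p S * exp (- (p * (sum d S * (D * (1 / 2)))))) \<partial>lborel) =
      ennreal (exp (- (p1 * (sum d S * D) / 2)) * (tree_term S / (1 / 2) ^ card S))"
      by (subst tree_weight_integral) (auto simp only: ennreal_mult'[OF exp_ge_zero] mem_Collect_eq)
  qed
  also have "\<dots> \<le> (\<Sum>S\<in>?I. ennreal (?\<epsilon> * tree_term S))"
  proof (intro sum_mono ennreal_leI)
    fix S assume S: "S \<in> ?I"
    obtain k where k: "card S = Suc k"
      using S finite_subset_V[of S] by (metis (mono_tags, lifting) card_eq_0_iff mem_Collect_eq not0_implies_Suc)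
    have "(real (card S) / w) * (real n / w) \<le> sum d S * D"
      using S sum_d_ge[of S] D_ge w_ge_1 sum_d_pos[of S] by (intro mult_mono) auto
    from mult_left_mono[OF this p1]
    have "real (card S) * (p1 * real n / (2 * w\<^sup>2)) \<le> p1 * (sum d S * D) / 2"
      by (simp add: power2_eq_square ac_simps)
    then have "exp (- (p1 * (sum d S * D) / 2)) \<le> exp (real (card S) * (- (p1 * real n / (2 * w\<^sup>2))))"
      by simp
    also have "\<dots> = exp (- (p1 * real n / (2 * w\<^sup>2))) ^ card S" by (rule exp_of_nat_mult)
    finally have "exp (- (p1 * (sum d S * D) / 2)) / (1 / 2) ^ card S \<le>
      exp (- (p1 * real n / (2 * w\<^sup>2))) ^ card S / (1 / 2) ^ card S" by (intro divide_right_mono) auto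
    also have "\<dots> = ?\<epsilon> ^ card S" by (simp add: power_mult_distrib power_divide)
    also have "\<dots> = ?\<epsilon> * ?\<epsilon> ^ k" by (simp only: k power_Suc)
    also have "\<dots> \<le> ?\<epsilon> * 1" using \<epsilon> by (intro mult_left_mono power_le_one) auto
    also have "\<dots> = ?\<epsilon>" by simp
    finally show "exp (- (p1 * (sum d S * D) / 2)) * (tree_term S / (1 / 2) ^ card S) \<le> ?\<epsilon> * tree_term S"
      using mult_right_mono[of "exp (- (p1 * (sum d S * D) / 2)) / (1 / 2) ^ card S" ?\<epsilon> "tree_term S"]
        tree_term_nonneg[of S] S by (simp add: ac_simps)
  qed
  also have "\<dots> = ennreal (?\<epsilon> * tree_sum)"
    unfolding tree_sum_def sum_distrib_left using tree_term_nonneg by (intro sum_ennreal) auto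
  finally show ?thesis by (simp add: add_left_mono)
qed

text \<open>The rate falls short of the one in the series by the factor b = 1 - d_S / D, and
  Bernoulli's inequality gives b^k >= 1 - k d_S / D. For k <= K the subtracted term is at most K^2
  w^2 / n, since d_S <= k w and D >= n / w.\<close>

lemma component_integral_le:
  assumes S: "S \<subseteq> {1..n}" "S \<noteq> {}" "real (card S) \<le> K" and \<delta>: "K\<^sup>2 * w\<^sup>2 / real n < 1" (is "?\<delta> < 1")
  shows "(\<integral>\<^sup>+p. indicator {0..} p * ennreal (tree_weight S * p ^ (card S - 1) * exp (- (p * (sum d S * (D - sum d S))))) \<partial>lborel) \<le>
    ennreal (tree_term S / (1 - ?\<delta>))"
proof -
  define b where "b = 1 - sum d S / D"
  have k1: "1 \<le> real (card S)"
  proof -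
    have "0 < card S" using S finite_subset_V[OF S(1)] by (simp add: card_gt_0_iff)
    then show ?thesis by linarith
  qed
  have "sum d S / D \<le> (real (card S) * w) / (real n / w)"
    using sum_d_le[OF S(1)] D_ge w_ge_1 n_ge_1 by (intro frac_le) auto
  then have "real (card S) * (sum d S / D) \<le> real (card S) * (real (card S) * w / (real n / w))"
    by (intro mult_left_mono) auto
  also have "\<dots> = (real (card S))\<^sup>2 * w\<^sup>2 / real n" by (simp add: power2_eq_square)
  also have "\<dots> \<le> ?\<delta>"
    using S(3) by (intro divide_right_mono mult_right_mono power_mono) auto
  finally have kd: "real (card S) * (sum d S / D) \<le> ?\<delta>" .
  have r0: "0 \<le> sum d S / D" using sum_d_pos[OF S(1,2)] D_pos by simp
  have "sum d S / D \<le> real (card S) * (sum d S / D)" using mult_right_mono[OF k1 r0] by simp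
  then have r1: "sum d S / D < 1" using kd \<delta> by linarith
  have b: "0 < b" using r1 by (simp add: b_def)
  have "1 - ?\<delta> \<le> 1 + real (card S) * (- (sum d S / D))" using kd by simp
  also have "\<dots> \<le> (1 + (- (sum d S / D))) ^ card S" using r1 by (intro Bernoulli_inequality) simp
  finally have pow: "1 - ?\<delta> \<le> b ^ card S" by (simp add: b_def)
  have "D - sum d S = D * b" using D_pos by (simp add: b_def algebra_simps)
  then have "(\<integral>\<^sup>+p. indicator {0..} p * ennreal (tree_weight S * p ^ (card S - 1) * exp (- (p * (sum d S * (D - sum d S))))) \<partial>lborel) =
    ennreal (tree_term S / b ^ card S)"
    using tree_weight_integral[OF S(1,2) b] by simp
  also have "\<dots> \<le> ennreal (tree_term S / (1 - ?\<delta>))"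
    using pow \<delta> tree_term_nonneg[OF S(1)] b by (intro ennreal_leI divide_left_mono) auto
  finally show ?thesis .
qed

text \<open>The three summands come from the components of size at most \<open>K\<close>, from the
  larger ones for \<open>p\<close> up to \<open>p0\<close>, and from all components for
  \<open>p\<close> above \<open>p0\<close>.\<close>

lemma mst_integral_le:
  assumes p0: "0 \<le> p0" "real n * exp (- (p0 * real n / (2 * w\<^sup>2))) \<le> 1"
    and K: "0 < K" and \<delta>: "K\<^sup>2 * w\<^sup>2 / real n < 1" (is "?\<delta> < 1")
  shows "mst_integral \<le> ennreal (tree_sum / (1 - ?\<delta>) + p0 * real n / K + 2 * exp 1 * w\<^sup>2 / real n)"
proof -
  let ?I = "{S. S \<subseteq> {1..n} \<and> S \<noteq> {} \<and> real (card S) \<le> K}"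
  let ?t = "\<lambda>p S. tree_weight S * p ^ (card S - 1) * exp (- (p * (sum d S * (D - sum d S))))"
  define F where "F S p = indicator {0..} p * ennreal (?t p S)" for S p
  have F [measurable]: "F S \<in> borel_measurable borel" for S unfolding F_def by measurable
  \<comment> \<open>If \<open>S\<close> has at most half of the vertices, its complement has weight
    at least n / (2 w), so d_S (D - d_S) is at least card S * a.\<close>
  define a where "a = real n / (2 * w\<^sup>2)"
  have a: "0 < a" using n_ge_1 w_ge_1 by (simp add: a_def)
  have na: "real n * exp (- (a * p0)) \<le> 1" using p0(2) by (simp add: a_def ac_simps)
  have t0: "0 \<le> ?t p S" if "S \<subseteq> {1..n}" "0 \<le> p" for p S
    using that tree_weight_nonneg by simp
  have pw: "indicator {0..} p * ennreal (mean_excess n \<alpha> p) \<le>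
    (\<Sum>S\<in>?I. F S p) + ennreal (real n / K) * indicator {0..p0} p +
    ennreal (exp 1 * real n) * (ennreal (exp (- (a * p))) * indicator {p0..} p)"
    (is "?m \<le> ?s + ?i + ?r") for p :: real
  proof (cases "0 \<le> p")
    case p: True
    show ?thesis
    proof (cases "p \<le> p0")
      case True
      have "mean_excess n \<alpha> p \<le> (\<Sum>S\<in>?I. component_prob p S) + real n / K"
        by (rule mean_excess_le_small[OF p K])
      also have "(\<Sum>S\<in>?I. component_prob p S) \<le> (\<Sum>S\<in>?I. ?t p S)"
        using component_prob_bounds(2)[OF _ _ p] by (intro sum_mono) (auto simp: D_def)
      finally have "?m \<le> ennreal ((\<Sum>S\<in>?I. ?t p S) + real n / K)" using p by (simp add: ennreal_leI)
      also have "\<dots> = ennreal (\<Sum>S\<in>?I. ?t p S) + ennreal (real n / K)"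
        using K p by (intro ennreal_plus sum_nonneg t0) auto
      also have "ennreal (\<Sum>S\<in>?I. ?t p S) = (\<Sum>S\<in>?I. ennreal (?t p S))"
        using p by (intro sum_ennreal[symmetric] t0) auto
      also have "\<dots> + ennreal (real n / K) = ?s + ?i" using p True by (simp add: F_def)
      finally show ?thesis by (rule order_trans) simp
    next
      case False
      let ?x = "exp (- (a * p))"
      \<comment> \<open>The condition on \<open>p0\<close> keeps \<open>real n * ?x\<close> at most
        1 from there on, as \<open>sum_Pow_nonempty_power_le\<close> requires.\<close>
      have "a * p0 \<le> a * p" using False a by simp
      then have "real n * ?x \<le> real n * exp (- (a * p0))" by (intro mult_left_mono) auto
      then have nx: "real n * ?x \<le> 1" using na by linarith
      have "mean_excess n \<alpha> p \<le> (\<Sum>S | S \<subseteq> {1..n} \<and> S \<noteq> {} \<and> 2 * card S \<le> n. component_prob p S)"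
        by (rule mean_excess_le_half[OF p])
      also have "\<dots> \<le> (\<Sum>S | S \<subseteq> {1..n} \<and> S \<noteq> {} \<and> 2 * card S \<le> n. ?x ^ card S)"
      proof (intro sum_mono)
        fix S assume "S \<in> {S. S \<subseteq> {1..n} \<and> S \<noteq> {} \<and> 2 * card S \<le> n}"
        then have S: "S \<subseteq> {1..n}" "S \<noteq> {}" "2 * card S \<le> n" by auto
        have "card ({1..n} - S) = n - card S" using S finite_subset_V[OF S(1)] by (simp add: card_Diff_subset)
        then have "real n / 2 \<le> real (card ({1..n} - S))" using S(3) by linarith
        then have "real n / 2 / w \<le> real (card ({1..n} - S)) / w"
          using w_ge_1 by (intro divide_right_mono) auto
        also have "\<dots> \<le> D - sum d S" unfolding D_diff[OF S(1)] by (intro sum_d_ge) auto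
        finally have "(real (card S) / w) * (real n / 2 / w) \<le> sum d S * (D - sum d S)"
          using sum_d_ge[OF S(1)] sum_d_pos[OF S(1,2)] w_ge_1 by (intro mult_mono) auto
        from mult_left_mono[OF this p]
        have "real (card S) * (a * p) \<le> p * (sum d S * (D - sum d S))"
          by (simp add: a_def power2_eq_square ac_simps)
        then have "exp (- (p * (sum d S * (D - sum d S)))) \<le> exp (real (card S) * (- (a * p)))" by simp
        also have "\<dots> = ?x ^ card S" by (rule exp_of_nat_mult)
        finally show "component_prob p S \<le> ?x ^ card S"
          using component_prob_bounds(1)[OF S(1,2) p] by (simp add: D_def)
      qed
      also have "\<dots> \<le> (\<Sum>S | S \<subseteq> {1..n} \<and> S \<noteq> {}. ?x ^ card S)"
        using finite_subsets by (intro sum_mono2) auto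
      also have "\<dots> \<le> exp 1 * real n * ?x" using nx by (intro sum_Pow_nonempty_power_le) auto
      finally have "?m \<le> ?r" using p False by (simp add: ennreal_leI ennreal_mult'[symmetric])
      then show ?thesis by (rule order_trans) simp
    qed
  qed simp
  have "mst_integral \<le> (\<integral>\<^sup>+p. (\<Sum>S\<in>?I. F S p) + ennreal (real n / K) * indicator {0..p0} p +
    ennreal (exp 1 * real n) * (ennreal (exp (- (a * p))) * indicator {p0..} p) \<partial>lborel)"
    unfolding mst_integral_def by (intro nn_integral_mono pw)
  also have "\<dots> = (\<Sum>S\<in>?I. \<integral>\<^sup>+p. F S p \<partial>lborel) + ennreal (real n / K) * ennreal p0 +
    ennreal (exp 1 * real n) * ennreal (exp (- (a * p0)) / a)"
    using p0(1) a by (simp add: nn_integral_add nn_integral_sum nn_integral_cmult nn_integral_exp_Ici)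
  also have "\<dots> \<le> (\<Sum>S\<in>?I. ennreal (tree_term S / (1 - ?\<delta>))) + ennreal (real n / K) * ennreal p0 +
    ennreal (exp 1 * real n) * ennreal (exp (- (a * p0)) / a)"
    using component_integral_le[OF _ _ _ \<delta>] unfolding F_def by (intro add_right_mono sum_mono) auto
  also have "\<dots> = ennreal ((\<Sum>S\<in>?I. tree_term S / (1 - ?\<delta>)) + real n / K * p0 + exp 1 * real n * (exp (- (a * p0)) / a))"
  proof -
    have t: "0 \<le> tree_term S / (1 - ?\<delta>)" if "S \<in> ?I" for S
      using that \<delta> by (intro divide_nonneg_nonneg tree_term_nonneg) auto
    then have "(\<Sum>S\<in>?I. ennreal (tree_term S / (1 - ?\<delta>))) = ennreal (\<Sum>S\<in>?I. tree_term S / (1 - ?\<delta>))"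
      by (intro sum_ennreal)
    moreover have "0 \<le> (\<Sum>S\<in>?I. tree_term S / (1 - ?\<delta>))" using t by (intro sum_nonneg)
    moreover have "0 \<le> real n / K * p0" "0 \<le> exp 1 * real n * (exp (- (a * p0)) / a)" using K p0(1) a by auto
    moreover have "ennreal (real n / K) * ennreal p0 = ennreal (real n / K * p0)"
      "ennreal (exp 1 * real n) * ennreal (exp (- (a * p0)) / a) = ennreal (exp 1 * real n * (exp (- (a * p0)) / a))"
      using K p0(1) a by (simp_all add: ennreal_mult'[symmetric])
    ultimately show ?thesis by (simp only: ennreal_plus add_nonneg_nonneg)
  qed
  also have "\<dots> \<le> ennreal (tree_sum / (1 - ?\<delta>) + p0 * real n / K + 2 * exp 1 * w\<^sup>2 / real n)"
  proof (intro ennreal_leI add_mono)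
    have "(\<Sum>S\<in>?I. tree_term S) \<le> tree_sum"
      unfolding tree_sum_def using finite_subsets by (intro sum_mono2) (auto intro: tree_term_nonneg)
    then show "(\<Sum>S\<in>?I. tree_term S / (1 - ?\<delta>)) \<le> tree_sum / (1 - ?\<delta>)"
      using \<delta> by (simp add: sum_divide_distrib[symmetric] divide_right_mono)
    \<comment> \<open>The same condition on \<open>p0\<close> reduces the tail integral to at most e
      / a.\<close>
    have "exp 1 * (real n * exp (- (a * p0))) / a \<le> exp 1 * 1 / a"
      using na a by (intro divide_right_mono mult_left_mono) auto
    also have "\<dots> = 2 * exp 1 * w\<^sup>2 / real n" by (simp add: a_def)
    finally show "exp 1 * real n * (exp (- (a * p0)) / a) \<le> 2 * exp 1 * w\<^sup>2 / real n" by simp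
  qed (simp add: ac_simps)
  finally show ?thesis .
qed

end

section \<open>The ratio of the mean to the series\<close>

context bounded_weights
begin

text \<open>No vertex set has more than \<open>n\<close> elements, so the series is a finite sum;
  starting at \<open>k = 1\<close> matches leaving out the empty set.\<close>

lemma infsum_eq_tree_sum:
  "(\<Sum>\<^sub>\<infinity>k\<in>{1..}. fact (k - 1) / (\<Sum>v\<in>{1..n}. d v) ^ k *
     (\<Sum>S | S \<subseteq> {1..n} \<and> card S = k. (\<Prod>v\<in>S. d v) / (\<Sum>v\<in>S. d v)\<^sup>2)) = tree_sum"
  (is "infsum ?f _ = _")
proof -
  have large: "?f k = 0" if "n < k" for k
  proof -
    have "card S \<noteq> k" if "S \<subseteq> {1..n}" for S using card_mono[OF _ that] \<open>n < k\<close> by simp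
    then have "{S. S \<subseteq> {1..n} \<and> card S = k} = {}" by blast
    then show ?thesis by (simp only: sum.empty mult_zero_right)
  qed
  have "infsum ?f {1..} = infsum ?f {1..n}"
  proof (rule infsum_cong_neutral)
    show "?f k = 0" if "k \<in> {1..} - {1..n}" for k using that by (intro large) auto
  qed simp_all
  also have "\<dots> = (\<Sum>k\<in>{1..n}. ?f k)" by simp
  also have "\<dots> = (\<Sum>k\<in>{1..n}. \<Sum>S | S \<in> {S. S \<subseteq> {1..n} \<and> S \<noteq> {}} \<and> card S = k. tree_term S)"
  proof (intro sum.cong refl)
    fix k assume k: "k \<in> {1..n}"
    have eq: "{S. S \<in> {S. S \<subseteq> {1..n} \<and> S \<noteq> {}} \<and> card S = k} = {S. S \<subseteq> {1..n} \<and> card S = k}"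
      using k by auto
    show "?f k = (\<Sum>S | S \<in> {S. S \<subseteq> {1..n} \<and> S \<noteq> {}} \<and> card S = k. tree_term S)"
      unfolding eq sum_distrib_left by (intro sum.cong) (auto simp: tree_term_def D_def)
  qed
  also have "\<dots> = tree_sum"
    unfolding tree_sum_def
  proof (rule sum.group)
    show "card ` {S. S \<subseteq> {1..n} \<and> S \<noteq> {}} \<subseteq> {1..n}"
    proof
      fix k assume "k \<in> card ` {S. S \<subseteq> {1..n} \<and> S \<noteq> {}}"
      then obtain S where S: "S \<subseteq> {1..n}" "S \<noteq> {}" "k = card S" by blast
      then have "card S \<noteq> 0" "card S \<le> n"
        using finite_subset_V[OF S(1)] card_mono[OF _ S(1)] by auto
      then show "k \<in> {1..n}" using S(3) by auto
    qed
    show "finite {S. S \<subseteq> {1..n} \<and> S \<noteq> {}}" by (rule finite_subsets)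
  qed simp
  finally show ?thesis .
qed

lemma tree_sum_pos: "0 < tree_sum"
  using w_ge_1 by (intro less_le_trans[OF _ tree_sum_ge]) auto

lemma divide_tree_sum_le: "0 \<le> x \<Longrightarrow> x / tree_sum \<le> w\<^sup>2 * x"
proof -
  assume x: "0 \<le> x"
  have "1 \<le> w\<^sup>2 * tree_sum" using tree_sum_ge w_ge_1 by (simp add: field_simps)
  from mult_left_mono[OF this x] show ?thesis using tree_sum_pos by (simp add: field_simps)
qed

lemma mst_ratio_bounds:
  assumes n: "2 \<le> n"
    and p1: "0 \<le> p1" "2 * exp (- (p1 * real n / (2 * w\<^sup>2))) \<le> 1" (is "?\<epsilon> \<le> 1")
    and p0: "0 \<le> p0" "real n * exp (- (p0 * real n / (2 * w\<^sup>2))) \<le> 1"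
    and K: "0 < K" and \<delta>: "K\<^sup>2 * w\<^sup>2 / real n < 1" (is "?\<delta> < 1")
  defines "c \<equiv> real (n choose 2) / (real (n choose 2) + 1)"
    and "r \<equiv> (\<integral>X. mst_weight n X \<partial>uniform_simplex n \<alpha>) / tree_sum"
  shows "c * (1 - ?\<epsilon> - w\<^sup>2 * p1) \<le> r"
    and "r \<le> c * (1 / (1 - ?\<delta>) + w\<^sup>2 * (p0 * real n / K + 2 * exp 1 * w\<^sup>2 / real n))"
proof -
  define L where "L = enn2real mst_integral"
  let ?err = "p0 * real n / K + 2 * exp 1 * w\<^sup>2 / real n"
  have err: "0 \<le> ?err" using p0(1) K by simp
  have up: "mst_integral \<le> ennreal (tree_sum / (1 - ?\<delta>) + p0 * real n / K + 2 * exp 1 * w\<^sup>2 / real n)"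
    by (rule mst_integral_le[OF p0 K \<delta>])
  \<comment> \<open>The upper bound shows the integral to be finite, so nothing is lost by
    \<open>enn2real\<close>.\<close>
  then have L: "mst_integral = ennreal L"
    unfolding L_def using le_less_trans[OF up ennreal_less_top] by simp
  have L0: "0 \<le> L" by (simp add: L_def)
  have "ennreal L \<le> ennreal (tree_sum / (1 - ?\<delta>) + ?err)"
    using up by (simp only: L add.assoc)
  moreover have "0 \<le> tree_sum / (1 - ?\<delta>)" using \<delta> tree_sum_nonneg by simp
  ultimately have "L \<le> tree_sum / (1 - ?\<delta>) + ?err"
    using ennreal_le_iff[OF add_nonneg_nonneg[OF _ err]] by blast
  then have "L / tree_sum \<le> (tree_sum / (1 - ?\<delta>) + ?err) / tree_sum"
    by (rule divide_right_mono) (rule tree_sum_nonneg)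
  also have "\<dots> = 1 / (1 - ?\<delta>) + ?err / tree_sum"
  proof -
    have "(t / a + e) / t = 1 / a + e / t" if "0 < t" for t a e :: real
      using that by (simp add: add_divide_distrib)
    then show ?thesis using tree_sum_pos .
  qed
  also have "\<dots> \<le> 1 / (1 - ?\<delta>) + w\<^sup>2 * ?err"
    by (rule add_left_mono[OF divide_tree_sum_le[OF err]])
  finally have upper: "L / tree_sum \<le> 1 / (1 - ?\<delta>) + w\<^sup>2 * ?err" .
  have e0: "0 \<le> ?\<epsilon> * tree_sum" by (intro mult_nonneg_nonneg tree_sum_nonneg) simp_all
  have "ennreal tree_sum \<le> ennreal L + ennreal p1 + ennreal (?\<epsilon> * tree_sum)"
    using tree_sum_le_mst_integral[OF p1] unfolding L .
  also have "\<dots> = ennreal (L + p1 + ?\<epsilon> * tree_sum)"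
    using L0 p1(1) e0 by (simp only: ennreal_plus add_nonneg_nonneg)
  finally have "tree_sum \<le> L + p1 + ?\<epsilon> * tree_sum"
    using ennreal_le_iff[OF add_nonneg_nonneg[OF add_nonneg_nonneg[OF L0 p1(1)] e0]] by blast
  then have "tree_sum - p1 - ?\<epsilon> * tree_sum \<le> L" by linarith
  then have "(tree_sum - p1 - ?\<epsilon> * tree_sum) / tree_sum \<le> L / tree_sum"
    by (rule divide_right_mono) (rule tree_sum_nonneg)
  moreover have "(tree_sum - p1 - ?\<epsilon> * tree_sum) / tree_sum = 1 - p1 / tree_sum - ?\<epsilon>"
  proof -
    have "(t - a - e * t) / t = 1 - a / t - e" if "0 < t" for t a e :: real
      using that by (simp add: diff_divide_distrib)
    then show ?thesis using tree_sum_pos .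
  qed
  ultimately have lower: "1 - ?\<epsilon> - w\<^sup>2 * p1 \<le> L / tree_sum"
    using divide_tree_sum_le[OF p1(1)] by linarith
  have "r = c * (L / tree_sum)"
    unfolding r_def c_def L_def mst_integral_def using integral_uniform_simplex_mst[OF n weight_pos] by simp
  moreover have "0 \<le> c" by (simp add: c_def)
  note mult_left_mono[OF lower this] mult_left_mono[OF upper this]
  ultimately show "c * (1 - ?\<epsilon> - w\<^sup>2 * p1) \<le> r" "r \<le> c * (1 / (1 - ?\<delta>) + w\<^sup>2 * ?err)"
    by (simp_all only:)
qed

end

theorem theorem2p10:
  fixes \<alpha> :: "nat \<Rightarrow> nat set \<Rightarrow> real" and d :: "nat \<Rightarrow> nat \<Rightarrow> real" and \<omega> :: "nat \<Rightarrow> real"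
  defines "\<omega> \<equiv> \<lambda>n. ln (real n) powr (1 / 10)"
  assumes "\<And>n. decomposes n (\<alpha> n) (d n)"
    and "\<And>n v. n \<ge> 3 \<Longrightarrow> v \<in> {1..n} \<Longrightarrow> d n v \<in> {inverse (\<omega> n)..\<omega> n}"
  shows "(\<lambda>n. \<integral>X. mst_weight n X \<partial>uniform_simplex n (\<alpha> n)) \<sim>[sequentially]
    (\<lambda>n. \<Sum>\<^sub>\<infinity>k\<in>{1..}. fact (k - 1) / (\<Sum>v\<in>{1..n}. d n v) ^ k *
       (\<Sum>S | S \<subseteq> {1..n} \<and> card S = k. (\<Prod>v\<in>S. d n v) / (\<Sum>v\<in>S. d n v)\<^sup>2))"
proof (rule asymp_equivI')
  let ?r = "\<lambda>n. (\<integral>X. mst_weight n X \<partial>uniform_simplex n (\<alpha> n)) /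
    (\<Sum>\<^sub>\<infinity>k\<in>{1..}. fact (k - 1) / (\<Sum>v\<in>{1..n}. d n v) ^ k *
       (\<Sum>S | S \<subseteq> {1..n} \<and> card S = k. (\<Prod>v\<in>S. d n v) / (\<Sum>v\<in>S. d n v)\<^sup>2))"
  \<comment> \<open>Only the polynomial orders of \<open>p1\<close> and \<open>K\<close> matter:
    exponents strictly between -1 and 0, respectively between 0 and 1/2, serve equally.\<close>
  define p1 where "p1 n = real n powr (- 1 / 2)" for n
  define p0 where "p0 n = 2 * (\<omega> n)\<^sup>2 * ln (real n) / real n" for n
  define K where "K n = real n powr (1 / 4)" for n
  define \<epsilon> where "\<epsilon> n = 2 * exp (- (p1 n * real n / (2 * (\<omega> n)\<^sup>2)))" for n
  define \<delta> where "\<delta> n = (K n)\<^sup>2 * (\<omega> n)\<^sup>2 / real n" for n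
  define c where "c n = real (n choose 2) / (real (n choose 2) + 1)" for n
  \<comment> \<open>As a rational function of \<open>n\<close>, \<open>c\<close> becomes accessible
    to \<open>real_asymp\<close>.\<close>
  have choose: "real (n choose 2) = real n * (real n - 1) / 2" for n
  proof -
    have "even (n * (n - 1))" by auto
    then have "2 * (n choose 2) = n * (n - 1)" by (simp add: choose_two)
    then have "2 * real (n choose 2) = real (n * (n - 1))" by (metis of_nat_mult of_nat_numeral)
    then show ?thesis by (cases n) (auto simp: algebra_simps)
  qed
  have c: "c \<longlonglongrightarrow> 1" unfolding c_def choose by real_asymp
  have \<epsilon>: "\<epsilon> \<longlonglongrightarrow> 0" unfolding \<epsilon>_def p1_def \<omega>_def by real_asymp
  have \<delta>: "\<delta> \<longlonglongrightarrow> 0" unfolding \<delta>_def K_def \<omega>_def by real_asymp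
  have lo: "(\<lambda>n. (\<omega> n)\<^sup>2 * p1 n) \<longlonglongrightarrow> 0" unfolding p1_def \<omega>_def by real_asymp
  have hi: "(\<lambda>n. (\<omega> n)\<^sup>2 * (p0 n * real n / K n + 2 * exp 1 * (\<omega> n)\<^sup>2 / real n)) \<longlonglongrightarrow> 0"
    unfolding p0_def K_def \<omega>_def by real_asymp
  have n3: "\<forall>\<^sub>F n :: nat in sequentially. 3 \<le> n" by (rule eventually_ge_at_top)
  have \<epsilon>1: "\<forall>\<^sub>F n in sequentially. \<epsilon> n < 1" using \<epsilon> by (rule order_tendstoD) simp
  have \<delta>1: "\<forall>\<^sub>F n in sequentially. \<delta> n < 1" using \<delta> by (rule order_tendstoD) simp
  have bounds: "\<forall>\<^sub>F n in sequentially. c n * (1 - \<epsilon> n - (\<omega> n)\<^sup>2 * p1 n) \<le> ?r n \<and>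
    ?r n \<le> c n * (1 / (1 - \<delta> n) + (\<omega> n)\<^sup>2 * (p0 n * real n / K n + 2 * exp 1 * (\<omega> n)\<^sup>2 / real n))"
    using n3 \<epsilon>1 \<delta>1
  proof eventually_elim
    case (elim n)
    \<comment> \<open>From e <= 3 <= n follows ln n >= 1, hence omega >= 1, as the locale
      demands.\<close>
    have "exp 1 \<le> real n" using exp_le elim(1) by linarith
    then have ln: "1 \<le> ln (real n)" using elim(1) by (subst ln_ge_iff) auto
    then have \<omega>: "1 \<le> \<omega> n" by (simp add: \<omega>_def ge_one_powr_ge_zero)
    interpret bounded_weights n "\<alpha> n" "d n" "\<omega> n"
    proof
      show "1 \<le> n" using elim(1) by simp
      show "decomposes n (\<alpha> n) (d n)" by (rule assms(2))
      show d: "d n v \<in> {inverse (\<omega> n)..\<omega> n}" if "v \<in> {1..n}" for v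
        by (rule assms(3)[OF elim(1) that])
      show "0 < d n v" if "v \<in> {1..n}" for v
      proof -
        have "0 < inverse (\<omega> n)" using \<omega> by simp
        also have "\<dots> \<le> d n v" using d[OF that] by simp
        finally show ?thesis .
      qed
      show "1 \<le> \<omega> n" by (rule \<omega>)
    qed
    \<comment> \<open>The exponent is minus ln n, so equality holds.\<close>
    have "real n * exp (- (p0 n * real n / (2 * (\<omega> n)\<^sup>2))) \<le> 1"
      using \<omega> elim(1) by (simp add: p0_def exp_minus)
    moreover have "0 \<le> p0 n" "0 \<le> p1 n" "0 < K n" using elim(1) ln by (auto simp: p0_def p1_def K_def)
    moreover have "2 \<le> n" using elim(1) by simp
    ultimately show ?case
      unfolding infsum_eq_tree_sum c_def \<epsilon>_def \<delta>_def
      using mst_ratio_bounds[of "p1 n" "p0 n" "K n"] elim(2,3)[unfolded \<epsilon>_def \<delta>_def]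
      by (intro conjI) simp_all
  qed
  show "?r \<longlonglongrightarrow> 1"
  proof (rule tendsto_sandwich)
    show "(\<lambda>n. c n * (1 - \<epsilon> n - (\<omega> n)\<^sup>2 * p1 n)) \<longlonglongrightarrow> 1"
      using tendsto_mult[OF c tendsto_diff[OF tendsto_diff[OF tendsto_const \<epsilon>] lo], of 1] by simp
    show "(\<lambda>n. c n * (1 / (1 - \<delta> n) + (\<omega> n)\<^sup>2 * (p0 n * real n / K n + 2 * exp 1 * (\<omega> n)\<^sup>2 / real n))) \<longlonglongrightarrow> 1"
      using tendsto_mult[OF c tendsto_add[OF tendsto_divide[OF tendsto_const tendsto_diff[OF tendsto_const \<delta>]] hi], of 1 1]
      by simp
    show "\<forall>\<^sub>F n in sequentially. c n * (1 - \<epsilon> n - (\<omega> n)\<^sup>2 * p1 n) \<le> ?r n"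
      "\<forall>\<^sub>F n in sequentially.
        ?r n \<le> c n * (1 / (1 - \<delta> n) + (\<omega> n)\<^sup>2 * (p0 n * real n / K n + 2 * exp 1 * (\<omega> n)\<^sup>2 / real n))"
      by (rule eventually_mono[OF bounds], blast)+
  qed
qed

end
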